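(* There is a constant $C\in\mathbb{R}$ such that the following holds. Let $a,b,c,n,x_0,y_0\in\mathbb{R}$ with $n\neq 0$, let $\Delta:=\sqrt{b^2-4ac}>0$, and assume $a,b,c,\Delta\in\mathbb{Z}$. Let $h\subset\mathbb{R}^2$ be the hyperbola \[ a(x-x_0)^2+b(x-x_0)(y-y_0)+c(y-y_0)^2=n, \] and let $H$ be the closure of one of the convex connected components of $\mathbb{R}^2\setminus h$. Then \[ 2\left(\frac{|n|}{\Delta}\right)^{1/3}-2\;\le\;\#\,\mathrm{vert}\big(\mathrm{conv}(H\cap\mathbb{Z}^2)\big)\;\le\; C\,m^{1/3}(\log_2 m+2), \] where $m:=\max\{2\Delta,\,|n|/\Delta\}$.
   Context: $\mathrm{conv}$ denotes convex hull and $\mathrm{vert}(P)$ the set of vertices of a (possibly unbounded) polyhedron $P$; $\#$ denotes cardinality. *)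

theory Defs
  imports "HOL-Analysis.Analysis"
begin

definition hyperbola ::
  "real \<Rightarrow> real \<Rightarrow> real \<Rightarrow> real \<Rightarrow> real \<Rightarrow> real \<Rightarrow> (real \<times> real) set" where
  "hyperbola a b c n x0 y0 =
     {(x, y). a * (x - x0)\<^sup>2 + b * (x - x0) * (y - y0) + c * (y - y0)\<^sup>2 = n}"

definition vert :: "'a::real_vector set \<Rightarrow> 'a set" where
  "vert P = {v. v extreme_point_of P}"

end

theory Submission
  imports Defs
begin

text \<open>Over the integers the form factors as \<open>\<kappa> L\<^sub>1 L\<^sub>2\<close> with primitive linear forms, and
  \<open>(s, t) = (L\<^sub>1, L\<^sub>2)\<close>, up to signs, carries \<open>\<int>\<^sup>2\<close> to a translate of a lattice of determinant
  \<open>\<delta> = \<Delta> / \<kappa>\<close> and \<open>H\<close> to \<open>s > 0, s t \<ge> \<nu>\<close> with \<open>\<nu> = |n| / \<kappa>\<close>.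

  Lower bound: put \<open>R = (\<nu> / \<delta>)\<^bsup>1/3\<^esup>\<close>. In every column \<open>s \<le> R\<close> the second difference of
  \<open>\<nu> / s\<close> is so large compared with the vertical period \<open>\<delta>\<close> that the lowest lattice point is a
  vertex; likewise in every row \<open>t \<le> R\<close>.

  Upper bound: the vertices form a decreasing strictly convex chain, and such a chain in an
  \<open>X\<close> by \<open>Y\<close> box has \<open>O((X Y / \<delta>)\<^bsup>1/3\<^esup> + 1)\<close> vertices, because most of its edges are short and
  their directions are distinct. Each dyadic strip \<open>2\<^sup>i \<le> s \<le> 2\<^bsup>i+1\<^esup>\<close> with \<open>s \<le> \<nu> / \<delta>\<close> has its
  vertices in a box of area \<open>2 \<nu>\<close>, symmetrically for \<open>t\<close>, and the remaining vertices lie in a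
  \<open>2 \<delta>\<close> by \<open>2 \<delta>\<close> box.\<close>

section \<open>Extreme points and convex lattice chains\<close>

text \<open>Adjoining \<open>v\<close> to the open half-space \<open>f v < f x\<close> keeps it
  convex, so the hull of \<open>S\<close> lies in that set. A proper convex combination of its
  points that equals \<open>v\<close> must have both ends at \<open>v\<close>.\<close>

lemma extreme_point_of_convex_hull_strict_minimum:
  fixes f :: "'a::real_vector \<Rightarrow> real"
  assumes f: "linear f" and v: "v \<in> S" and min: "\<And>w. w \<in> S \<Longrightarrow> w \<noteq> v \<Longrightarrow> f v < f w"
  shows "v extreme_point_of (convex hull S)"
proof -
  interpret linear f by (rule f)
  let ?T = "insert v {x. f v < f x}"
  have "convex ?T"
  proof (rule convexI)
    fix x y :: 'a and \<alpha> \<beta> :: real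
    assume x: "x \<in> ?T" and y: "y \<in> ?T" and ab: "0 \<le> \<alpha>" "0 \<le> \<beta>" "\<alpha> + \<beta> = 1"
    have le: "f v \<le> f x" "f v \<le> f y" using x y by auto
    have eq: "f (\<alpha> *\<^sub>R x + \<beta> *\<^sub>R y) = \<alpha> * f x + \<beta> * f y" by (simp add: add scale)
    have b: "\<beta> = 1 - \<alpha>" using ab by simp
    consider "\<alpha> = 0" | "\<beta> = 0" | "\<alpha> > 0" "\<beta> > 0" using ab by fastforce
    then show "\<alpha> *\<^sub>R x + \<beta> *\<^sub>R y \<in> ?T"
    proof cases
      case 1 then show ?thesis using y ab by simp
    next
      case 2 then show ?thesis using x ab by simp
    next
      case 3
      show ?thesis
      proof (cases "x = v \<and> y = v")
        case True
        then show ?thesis by (simp add: b scaleR_left_diff_distrib)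
      next
        case False
        then have "f v < f x \<or> f v < f y" using x y by auto
        then have "\<alpha> * (f x - f v) + \<beta> * (f y - f v) > 0"
          using le 3 by (smt (verit) mult_pos_pos mult_nonneg_nonneg)
        then have "f v < \<alpha> * f x + \<beta> * f y" by (simp add: b algebra_simps)
        then show ?thesis by (simp add: eq)
      qed
    qed
  qed
  moreover have "S \<subseteq> ?T" using min by auto
  ultimately have sub: "convex hull S \<subseteq> ?T" by (simp add: hull_minimal)
  show ?thesis
    unfolding extreme_point_of_def
  proof (intro conjI ballI notI)
    show "v \<in> convex hull S" using v by (rule hull_inc)
    fix a b assume "a \<in> convex hull S" "b \<in> convex hull S" and o: "v \<in> open_segment a b"
    then have T: "a \<in> ?T" "b \<in> ?T" using sub by auto
    from o obtain u where u: "a \<noteq> b" "0 < u" "u < 1" "v = (1 - u) *\<^sub>R a + u *\<^sub>R b"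
      by (auto simp: in_segment)
    have "f v = (1 - u) * f a + u * f b" by (simp add: u(4) add scale)
    then have z: "(1 - u) * (f a - f v) + u * (f b - f v) = 0" by (simp add: algebra_simps)
    have "f a > f v \<or> f b > f v" using T u(1) by auto
    then show False using z u(2,3) T
      by (smt (verit) mult_pos_pos mult_nonneg_nonneg insertE mem_Collect_eq)
  qed
qed

text \<open>The exclusion test behind the upper bound: a vertex is never the midpoint of two
  distinct points of the hull.\<close>

lemma extreme_point_symmetric_pair:
  fixes v d :: "'a::real_vector"
  assumes "v extreme_point_of P" "v - d \<in> P" "v + d \<in> P"
  shows "d = 0"
proof (rule ccontr)
  assume "d \<noteq> 0"
  then have "(v + d) - (v - d) \<noteq> 0" by (simp flip: scaleR_2)
  then have "v - d \<noteq> v + d" by (metis right_minus_eq)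
  moreover have "v = (1 - 1/2) *\<^sub>R (v - d) + (1/2::real) *\<^sub>R (v + d)"
    by (simp add: algebra_simps flip: scaleR_left_distrib)
  ultimately have "v \<in> open_segment (v - d) (v + d)"
    unfolding in_segment by (intro conjI exI[of _ "1/2::real"]) auto
  then show False using assms by (auto simp: extreme_point_of_def)
qed

section \<open>Counting lattice directions and edges of convex chains\<close>

text \<open>Points at distance at least \<open>d\<close> have different values of
  \<open>\<lfloor>x / d\<rfloor>\<close>, so counting these integers suffices.\<close>

lemma card_separated_reals_le:
  fixes A :: "real set"
  assumes d: "d > 0" and R: "R \<ge> 0" and A: "A \<subseteq> {0..R}"
    and sep: "\<And>x y. x \<in> A \<Longrightarrow> y \<in> A \<Longrightarrow> x \<noteq> y \<Longrightarrow> d \<le> \<bar>x - y\<bar>"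
  shows "finite A" "real (card A) \<le> R / d + 1"
proof -
  let ?g = "\<lambda>x. \<lfloor>x / d\<rfloor>"
  have inj: "inj_on ?g A"
  proof (rule inj_onI, rule ccontr)
    fix x y assume xy: "x \<in> A" "y \<in> A" "?g x = ?g y" "x \<noteq> y"
    have "\<bar>x / d - y / d\<bar> < 1" using xy(3) by linarith
    moreover have "\<bar>x / d - y / d\<bar> = \<bar>x - y\<bar> / d" using d by (simp add: diff_divide_distrib[symmetric])
    ultimately show False using sep[OF xy(1,2,4)] d by (simp add: field_simps)
  qed
  have im: "?g ` A \<subseteq> {0..\<lfloor>R / d\<rfloor>}"
  proof (rule image_subsetI)
    fix x assume "x \<in> A"
    then have "0 \<le> x" "x \<le> R" using A by auto
    then show "?g x \<in> {0..\<lfloor>R / d\<rfloor>}"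
      using d by (auto intro!: floor_mono divide_right_mono)
  qed
  show fin: "finite A" using inj im by (meson finite_atLeastAtMost_int finite_subset finite_imageD)
  have "card A \<le> card {0..\<lfloor>R / d\<rfloor>}"
    using inj im by (metis card_image card_mono finite_atLeastAtMost_int)
  moreover have "R / d \<ge> 0" using R d by simp
  ultimately show "real (card A) \<le> R / d + 1" by simp linarith
qed

text \<open>Two slopes \<open>q / p\<close> differ by \<open>det / (p p')\<close>, hence by at least \<open>\<delta> / X\<^sup>2\<close>.\<close>

lemma card_directions_in_half_box_le:
  fixes p q :: "'i \<Rightarrow> real"
  assumes d: "\<delta> > 0" and X: "X > 0" and Y: "Y > 0"
    and pos: "\<And>i. i \<in> I \<Longrightarrow> 0 < p i" "\<And>i. i \<in> I \<Longrightarrow> p i \<le> X" "\<And>i. i \<in> I \<Longrightarrow> 0 < q i"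
    and slope: "\<And>i. i \<in> I \<Longrightarrow> q i * X \<le> p i * Y"
    and det: "\<And>i j. i \<in> I \<Longrightarrow> j \<in> I \<Longrightarrow> i \<noteq> j \<Longrightarrow> \<delta> \<le> \<bar>p i * q j - p j * q i\<bar>"
  shows "finite I" "real (card I) \<le> X * Y / \<delta> + 1"
proof -
  let ?g = "\<lambda>i. q i / p i"
  have sep: "\<delta> / X\<^sup>2 \<le> \<bar>?g i - ?g j\<bar>" if "i \<in> I" "j \<in> I" "i \<noteq> j" for i j
  proof -
    have "p i * p j \<le> X * X" using pos that by (intro mult_mono) (auto simp: less_imp_le X)
    then have "\<delta> / X\<^sup>2 \<le> \<bar>p j * q i - p i * q j\<bar> / (p i * p j)"
      using det[of j i] that pos d by (intro frac_le) (auto simp: power2_eq_square)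
    also have "\<dots> = \<bar>?g i - ?g j\<bar>"
    proof -
      have "?g i - ?g j = (p j * q i - p i * q j) / (p i * p j)"
        using pos(1)[OF that(1)] pos(1)[OF that(2)] by (simp add: field_simps)
      then show ?thesis using pos(1)[OF that(1)] pos(1)[OF that(2)] by (simp add: abs_divide)
    qed
    finally show ?thesis .
  qed
  have d2: "\<delta> / X\<^sup>2 > 0" using d X by simp
  have inj: "inj_on ?g I"
  proof (rule inj_onI, rule ccontr)
    fix i j assume "i \<in> I" "j \<in> I" "?g i = ?g j" "i \<noteq> j"
    then show False using sep[of i j] d2 by simp
  qed
  have sub: "?g ` I \<subseteq> {0..Y / X}"
  proof (rule image_subsetI)
    fix i assume i: "i \<in> I"
    have "q i / p i \<le> Y / X" using slope[OF i] pos(1)[OF i] X by (simp add: field_simps)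
    then show "?g i \<in> {0..Y / X}" using pos(1,3)[OF i] by simp
  qed
  note * = card_separated_reals_le[OF d2 _ sub]
  have YX: "0 \<le> Y / X" using X Y by simp
  have sep': "\<delta> / X\<^sup>2 \<le> \<bar>x - y\<bar>" if "x \<in> ?g ` I" "y \<in> ?g ` I" "x \<noteq> y" for x y
    using that sep by blast
  show "finite I" using *(1)[OF YX sep'] inj finite_imageD by blast
  have "real (card I) \<le> Y / X / (\<delta> / X\<^sup>2) + 1"
    using *(2)[OF YX sep'] card_image[OF inj] by simp
  also have "Y / X / (\<delta> / X\<^sup>2) = X * Y / \<delta>" using X by (simp add: power2_eq_square field_simps)
  finally show "real (card I) \<le> X * Y / \<delta> + 1" .
qed

text \<open>The diagonal cuts the box into two half boxes; the steep half becomes a flat one when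
  the coordinates are exchanged.\<close>

lemma card_directions_in_box_le:
  fixes p q :: "'i \<Rightarrow> real"
  assumes d: "\<delta> > 0" and X: "X > 0" and Y: "Y > 0"
    and pos: "\<And>i. i \<in> I \<Longrightarrow> 0 < p i" "\<And>i. i \<in> I \<Longrightarrow> p i \<le> X"
      "\<And>i. i \<in> I \<Longrightarrow> 0 < q i" "\<And>i. i \<in> I \<Longrightarrow> q i \<le> Y"
    and det: "\<And>i j. i \<in> I \<Longrightarrow> j \<in> I \<Longrightarrow> i \<noteq> j \<Longrightarrow> \<delta> \<le> \<bar>p i * q j - p j * q i\<bar>"
  shows "real (card I) \<le> 2 * X * Y / \<delta> + 2"
proof -
  let ?A = "{i \<in> I. q i * X \<le> p i * Y}" and ?B = "{i \<in> I. p i * Y \<le> q i * X}"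
  have A: "real (card ?A) \<le> X * Y / \<delta> + 1"
    by (rule card_directions_in_half_box_le(2)[OF d X Y, where p = p and q = q])
      (use pos det in auto)
  have B: "real (card ?B) \<le> Y * X / \<delta> + 1"
  proof (rule card_directions_in_half_box_le(2)[OF d Y X, where p = q and q = p])
    fix i j assume "i \<in> ?B" "j \<in> ?B" "i \<noteq> j"
    then show "\<delta> \<le> \<bar>q i * p j - q j * p i\<bar>" using det[of i j] by (auto simp: mult.commute abs_minus_commute)
  qed (use pos in auto)
  have "I = ?A \<union> ?B" by auto
  then have "card I \<le> card ?A + card ?B" using card_Un_le[of ?A ?B] by simp
  then have "real (card I) \<le> real (card ?A) + real (card ?B)" by linarith
  moreover have "2 * X * Y / \<delta> = X * Y / \<delta> + Y * X / \<delta>" by (simp add: add_divide_distrib[symmetric])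
  ultimately show ?thesis using A B by linarith
qed

lemma powr_third_cube: "x > 0 \<Longrightarrow> (x powr (1 / 3)) ^ 3 = (x::real)"
  by (simp add: powr_powr flip: powr_numeral)

text \<open>At least half of the \<open>k\<close> edges fit into a box of size \<open>4 X / k\<close> by \<open>4 Y / k\<close>, and
  their directions are distinct.\<close>

lemma card_convex_chain_le:
  fixes F :: "(real \<times> real) set"
  assumes fin: "finite F" and d: "\<delta> > 0" and X: "X > 0" and Y: "Y > 0"
    and box: "F \<subseteq> {x0..x0 + X} \<times> {y0..y0 + Y}"
    and anti: "\<And>u v. \<lbrakk>u \<in> F; v \<in> F; u \<noteq> v; fst u \<le> fst v\<rbrakk> \<Longrightarrow> fst u < fst v \<and> snd v < snd u"
    and conv: "\<And>u v w. \<lbrakk>u \<in> F; v \<in> F; w \<in> F; fst u < fst v; fst v < fst w\<rbrakk> \<Longrightarrow>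
      (snd v - snd u) * (fst w - fst v) < (snd w - snd v) * (fst v - fst u)"
    and det: "\<And>u v w z. \<lbrakk>u \<in> F; v \<in> F; w \<in> F; z \<in> F;
      (fst v - fst u) * (snd z - snd w) \<noteq> (fst z - fst w) * (snd v - snd u)\<rbrakk> \<Longrightarrow>
      \<delta> \<le> \<bar>(fst v - fst u) * (snd z - snd w) - (fst z - fst w) * (snd v - snd u)\<bar>"
  shows "real (card F) \<le> 9 + 6 * (X * Y / \<delta>) powr (1 / 3)"
proof (cases "card F \<le> 9")
  case True
  then show ?thesis by (simp add: add_increasing2)
next
  case False
  define k where "k = card F - 1"
  have k: "card F = Suc k" "k \<ge> 9" using False by (auto simp: k_def)
  have inj: "inj_on fst F"
    by (rule inj_onI) (metis anti less_irrefl order_refl)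
  define xs where "xs = sorted_list_of_set (fst ` F)"
  have len: "length xs = Suc k" using k(1) by (simp add: xs_def card_image[OF inj])
  have set: "set xs = fst ` F" using fin by (simp add: xs_def)
  define e where "e i = inv_into F fst (xs ! i)" for i
  have e: "e i \<in> F" "fst (e i) = xs ! i" if "i \<le> k" for i
    using that len set unfolding e_def
    by (metis inv_into_into le_imp_less_Suc nth_mem, metis f_inv_into_f le_imp_less_Suc nth_mem)
  have lt: "fst (e i) < fst (e j)" if "i < j" "j \<le> k" for i j
  proof -
    have "sorted_wrt (<) xs" unfolding xs_def by simp
    then show ?thesis using that len e(2)[of i] e(2)[of j] by (simp add: sorted_wrt_nth_less)
  qed
  have gt: "snd (e j) < snd (e i)" if "i < j" "j \<le> k" for i j
    using anti[of "e i" "e j"] e(1)[of i] e(1)[of j] lt[OF that] that by fastforce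
  define p q where "p i = fst (e (Suc i)) - fst (e i)" and "q i = snd (e i) - snd (e (Suc i))" for i
  have pos: "p i > 0" "q i > 0" if "i < k" for i
    using lt[of i "Suc i"] gt[of i "Suc i"] that by (auto simp: p_def q_def)
  have slope: "q j * p i < q i * p j" if "i < j" "j < k" for i j
  proof (cases "j = Suc i")
    case True
    then show ?thesis
      using conv[of "e i" "e j" "e (Suc j)"] e(1)[of i] e(1)[of j] e(1)[of "Suc j"]
        lt[of i j] lt[of j "Suc j"] that by (simp add: p_def q_def algebra_simps)
  next
    case False
    \<comment> \<open>The chord from \<open>e (Suc i)\<close> to \<open>e j\<close> serves as
      intermediary: its rate of descent \<open>Q / P\<close> lies strictly between those of the
      edges \<open>i\<close> and \<open>j\<close>.\<close>
    define P Q where "P = fst (e j) - fst (e (Suc i))" and "Q = snd (e (Suc i)) - snd (e j)"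
    have P: "P > 0" using lt[of "Suc i" j] False that by (simp add: P_def)
    have 1: "Q * p i < q i * P"
      using conv[of "e i" "e (Suc i)" "e j"] e(1)[of i] e(1)[of j] e(1)[of "Suc i"]
        lt[of i "Suc i"] lt[of "Suc i" j] that False by (simp add: p_def q_def P_def Q_def algebra_simps)
    have 2: "q j * P < Q * p j"
      using conv[of "e (Suc i)" "e j" "e (Suc j)"] e(1)[of "Suc j"] e(1)[of j] e(1)[of "Suc i"]
        lt[of j "Suc j"] lt[of "Suc i" j] that False by (simp add: p_def q_def P_def Q_def algebra_simps)
    have "q j * p i * P < Q * p j * p i" using mult_strict_right_mono[OF 2 pos(1)[of i]] that by (simp add: mult_ac)
    also have "\<dots> < q i * p j * P" using mult_strict_right_mono[OF 1 pos(1)[of j]] that by (simp add: mult_ac)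
    finally show ?thesis using P by simp
  qed
  have edet: "\<delta> \<le> \<bar>p i * q j - p j * q i\<bar>" if "i < k" "j < k" "i \<noteq> j" for i j
  proof -
    have ne: "p i * q j \<noteq> p j * q i"
      using slope[of i j] slope[of j i] that by (cases i j rule: linorder_cases) (auto simp: mult_ac)
    \<comment> \<open>Since \<open>q\<close> records drops, the determinant in \<open>det\<close>
      appears here with the opposite sign.\<close>
    have "(p i * q j \<noteq> p j * q i) \<longrightarrow> \<delta> \<le> \<bar>- (p i * q j - p j * q i)\<bar>"
      using det[of "e i" "e (Suc i)" "e j" "e (Suc j)"] e(1)[of i] e(1)[of "Suc i"] e(1)[of j] e(1)[of "Suc j"]
        that unfolding p_def q_def by (simp add: algebra_simps)
    then show ?thesis using ne by (simp only: abs_minus_cancel) blast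
  qed
  have sum_p: "(\<Sum>i<k. p i) \<le> X"
  proof -
    have "(\<Sum>i<k. p i) = fst (e k) - fst (e 0)" unfolding p_def by (rule sum_lessThan_telescope)
    also have "\<dots> \<le> X" using subsetD[OF box e(1)[of k]] subsetD[OF box e(1)[of 0]] by (auto simp: mem_Times_iff)
    finally show ?thesis .
  qed
  have sum_q: "(\<Sum>i<k. q i) \<le> Y"
  proof -
    have "(\<Sum>i<k. q i) = snd (e 0) - snd (e k)" unfolding q_def by (rule sum_lessThan_telescope')
    also have "\<dots> \<le> Y" using subsetD[OF box e(1)[of k]] subsetD[OF box e(1)[of 0]] by (auto simp: mem_Times_iff)
    finally show ?thesis .
  qed
  \<comment> \<open>Markov's inequality: at most a quarter of the values can exceed four times the
    average bound \<open>Z / k\<close>.\<close>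
  have few: "real (card {i. i < k \<and> f i > 4 * Z / k}) \<le> k / 4"
    if f: "\<And>i. i < k \<Longrightarrow> f i > 0" "(\<Sum>i<k. f i) \<le> Z" "Z > 0" for f :: "nat \<Rightarrow> real" and Z
  proof -
    let ?B = "{i. i < k \<and> f i > 4 * Z / k}"
    have "real (card ?B) * (4 * Z / k) \<le> sum f ?B"
      using sum_bounded_below[of ?B "4 * Z / k" f] by (simp add: less_imp_le)
    also have "\<dots> \<le> (\<Sum>i<k. f i)" using f(1) by (intro sum_mono2) (auto simp: less_imp_le)
    finally have "real (card ?B) * (4 * Z / k) \<le> Z" using f(2) by simp
    then show ?thesis using f(3) k(2) by (simp add: field_simps)
  qed
  let ?G = "{i. i < k \<and> p i \<le> 4 * X / k \<and> q i \<le> 4 * Y / k}"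
  let ?Bp = "{i. i < k \<and> p i > 4 * X / k}" and ?Bq = "{i. i < k \<and> q i > 4 * Y / k}"
  have "{..<k} = ?G \<union> (?Bp \<union> ?Bq)" by auto
  then have "k = card (?G \<union> (?Bp \<union> ?Bq))" by (metis card_lessThan)
  then have "k \<le> card ?G + (card ?Bp + card ?Bq)"
    using card_Un_le[of ?G "?Bp \<union> ?Bq"] card_Un_le[of ?Bp ?Bq] by linarith
  then have "real k \<le> real (card ?G) + (real (card ?Bp) + real (card ?Bq))" by linarith
  then have G: "k / 2 \<le> real (card ?G)"
    using few[OF pos(1) sum_p X] few[OF pos(2) sum_q Y] by linarith
  have kpos: "real k > 0" using k(2) by simp
  have "real (card ?G) \<le> 2 * (4 * X / k) * (4 * Y / k) / \<delta> + 2"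
    by (rule card_directions_in_box_le[OF d, where p = p and q = q]) (use pos edet X Y kpos in auto)
  also have "2 * (4 * X / k) * (4 * Y / k) / \<delta> = 32 * (X * Y / \<delta>) / (real k)\<^sup>2"
    by (simp add: power2_eq_square)
  finally have "k / 2 - 2 \<le> 32 * (X * Y / \<delta>) / (real k)\<^sup>2" using G by linarith
  \<comment> \<open>The cutoff at 9 points, paid for by the additive 9 of the bound, makes this
    true.\<close>
  moreover have "k / 4 \<le> real k / 2 - 2" using k(2) by simp
  ultimately have "k / 4 \<le> 32 * (X * Y / \<delta>) / (real k)\<^sup>2" by linarith
  then have "k / 4 * (real k)\<^sup>2 \<le> 32 * (X * Y / \<delta>)" using kpos by (subst (asm) pos_le_divide_eq) auto
  then have k3: "real k ^ 3 \<le> 128 * (X * Y / \<delta>)" by (simp add: power2_eq_square power3_eq_cube)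
  define \<rho> where "\<rho> = (X * Y / \<delta>) powr (1 / 3)"
  have XY: "X * Y / \<delta> > 0" using X Y d by simp
  have "\<rho> ^ 3 = X * Y / \<delta>"
    unfolding \<rho>_def using XY by (rule powr_third_cube)
  \<comment> \<open>The constant 6 is chosen so that \<open>6 ^ 3 = 216\<close> exceeds 128.\<close>
  then have "real k ^ 3 \<le> (6 * \<rho>) ^ 3" using k3 XY by (simp add: power_mult_distrib)
  then have "real k \<le> 6 * \<rho>" by (subst (asm) power_mono_iff) (auto simp: \<rho>_def)
  then show ?thesis using k(1) by (simp add: \<rho>_def)
qed

text \<open>Extreme points are singleton faces, and injective linear maps carry faces to
  faces.\<close>

lemma vert_injective_linear_image:
  assumes "linear f" "inj f"
  shows "vert (f ` S) = f ` vert S"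
proof -
  have "f x \<in> vert (f ` S) \<longleftrightarrow> x \<in> vert S" for x
    using face_of_linear_image[OF assms, of "{x}" S] by (simp add: vert_def face_of_singleton)
  moreover have "vert (f ` S) \<subseteq> range f" by (auto simp: vert_def extreme_point_of_def)
  ultimately show ?thesis by auto
qed

section \<open>Lattice points above a hyperbola \<open>s t = \<nu>\<close>\<close>

text \<open>\<open>\<Gamma>\<close> models a translate of a lattice of determinant \<open>\<delta>\<close> whose two coordinate projections
  are translates of \<open>\<int>\<close>; each of its rows and columns is then invariant under shifts by \<open>\<delta>\<close>.\<close>

locale hyperbolic_coset =
  fixes \<Gamma> :: "(real \<times> real) set" and \<delta> \<nu> :: real
  assumes delta: "\<delta> \<ge> 1" and nu: "\<nu> > 0"
    and parallelogram: "\<lbrakk>u \<in> \<Gamma>; v \<in> \<Gamma>; w \<in> \<Gamma>\<rbrakk> \<Longrightarrow> u + v - w \<in> \<Gamma>"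
    and det: "\<lbrakk>u \<in> \<Gamma>; v \<in> \<Gamma>; w \<in> \<Gamma>; z \<in> \<Gamma>;
      (fst v - fst u) * (snd z - snd w) \<noteq> (fst z - fst w) * (snd v - snd u)\<rbrakk> \<Longrightarrow>
      \<delta> \<le> \<bar>(fst v - fst u) * (snd z - snd w) - (fst z - fst w) * (snd v - snd u)\<bar>"
    and shift_fst: "z \<in> \<Gamma> \<Longrightarrow> z + (of_int i * \<delta>, 0) \<in> \<Gamma>"
    and shift_snd: "z \<in> \<Gamma> \<Longrightarrow> z + (0, of_int i * \<delta>) \<in> \<Gamma>"
    and columns: "\<exists>\<sigma>. fst ` \<Gamma> = {s. s - \<sigma> \<in> \<int>}"
    and rows: "\<exists>\<sigma>. snd ` \<Gamma> = {t. t - \<sigma> \<in> \<int>}"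
begin

section \<open>The chain structure of the vertices\<close>

text \<open>In the application this is the image of \<open>H \<inter> \<int> \<times> \<int>\<close>
  under the two linear forms.\<close>

definition region :: "(real \<times> real) set" where
  "region = {z \<in> \<Gamma>. fst z > 0 \<and> \<nu> \<le> fst z * snd z}"

abbreviation "V \<equiv> vert (convex hull region)"

lemma region_pos: "z \<in> region \<Longrightarrow> fst z > 0 \<and> snd z > 0"
  using nu by (auto simp: region_def) (meson less_le_trans zero_less_mult_pos)

lemma V_region: "V \<subseteq> region"
  using extreme_point_of_convex_hull unfolding vert_def by blast

lemma region_add:
  assumes "z \<in> region" "z + d \<in> \<Gamma>" "fst d \<ge> 0" "snd d \<ge> 0"
  shows "z + d \<in> region"
proof -
  have "fst z * snd z \<le> (fst z + fst d) * (snd z + snd d)"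
    using assms region_pos[OF assms(1)] by (intro mult_mono) auto
  then show ?thesis using assms by (auto simp: region_def)
qed

text \<open>If \<open>x\<close> lies weakly below and to the left of \<open>y\<close>, the
  reflection \<open>y + (y - x)\<close> stays in the region. Then \<open>y\<close> is the midpoint
  of two hull points, which for a vertex forces \<open>x = y\<close>.\<close>

lemma V_antichain:
  assumes u: "u \<in> V" and v: "v \<in> V" and "u \<noteq> v" "fst u \<le> fst v"
  shows "fst u < fst v \<and> snd v < snd u"
proof -
  have nodom: "y = x" if "x \<in> V" "y \<in> V" "fst x \<le> fst y" "snd x \<le> snd y" for x y
  proof -
    have r: "x \<in> region" "y \<in> region" using that V_region by auto
    have "y + (y - x) \<in> region"
      using r parallelogram[of y y x] that by (intro region_add) (auto simp: region_def add_diff_eq)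
    then have "y - x = 0"
      using extreme_point_symmetric_pair[of y "convex hull region" "y - x"] r that(2)
      by (simp add: vert_def hull_inc)
    then show ?thesis by simp
  qed
  show ?thesis
  proof (rule ccontr)
    assume "\<not> ?thesis"
    then have "snd u \<le> snd v \<or> fst v \<le> fst u \<and> snd v \<le> snd u" using assms(4) by linarith
    then show False using nodom[OF u v] nodom[OF v u] assms(3,4) by blast
  qed
qed

text \<open>The column above \<open>z\<close> contains points of the region arbitrarily high up, and
  \<open>z + (0, \<tau>)\<close> is a convex combination of \<open>z\<close> and one of them. This
  allows chords to be raised vertically inside the hull.\<close>

lemma hull_region_upward:
  assumes "z \<in> region" "\<tau> \<ge> 0"
  shows "z + (0, \<tau>) \<in> convex hull region"
proof -
  obtain i :: nat where i: "\<tau> < of_nat i" using reals_Archimedean2 by blast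
  then have "real i * 1 \<le> real i * \<delta>" using delta by (intro mult_left_mono) auto
  then have i\<delta>: "\<tau> < i * \<delta>" using i by simp
  have "z + (0, of_nat i * \<delta>) \<in> region"
    using assms shift_snd[of z "int i"] delta by (intro region_add) (auto simp: region_def)
  then have "z + (0, of_nat i * \<delta>) \<in> convex hull region" "z \<in> convex hull region"
    using assms by (auto intro: hull_inc)
  then have "(1 - \<tau> / (i * \<delta>)) *\<^sub>R z + (\<tau> / (i * \<delta>)) *\<^sub>R (z + (0, of_nat i * \<delta>)) \<in> convex hull region"
    using assms(2) i\<delta> by (intro convexD_alt) auto
  moreover have "(1 - \<tau> / (i * \<delta>)) *\<^sub>R z + (\<tau> / (i * \<delta>)) *\<^sub>R (z + (0, of_nat i * \<delta>)) = z + (0, \<tau>)"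
  proof -
    have ne: "i * \<delta> \<noteq> 0" using i\<delta> assms(2) by linarith
    have "(1 - c) *\<^sub>R z + c *\<^sub>R (z + w) = z + c *\<^sub>R w" for c w
      by (simp add: algebra_simps)
    then show ?thesis using ne by simp
  qed
  ultimately show ?thesis by simp
qed

text \<open>If \<open>v\<close> were on or above the chord from \<open>u\<close> to
  \<open>w\<close>, that chord could be raised inside the hull until it passed through
  \<open>v\<close>, so \<open>v\<close> would lie in an open segment of the hull.\<close>

lemma V_strictly_convex:
  assumes "u \<in> V" "v \<in> V" "w \<in> V" and lt: "fst u < fst v" "fst v < fst w"
  shows "(snd v - snd u) * (fst w - fst v) < (snd w - snd v) * (fst v - fst u)"
proof (rule ccontr)
  assume neg: "\<not> ?thesis"
  \<comment> \<open>\<open>c\<close> is the relative horizontal position of \<open>v\<close> between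
    \<open>u\<close> and \<open>w\<close>, and \<open>\<tau>\<close> its height above the
    chord.\<close>
  define c where "c = (fst v - fst u) / (fst w - fst u)"
  define \<tau> where "\<tau> = snd v - ((1 - c) * snd u + c * snd w)"
  have c: "0 < c" "c < 1" using lt by (auto simp: c_def)
  have "fst v - fst u = c * (fst w - fst u)" using lt by (simp add: c_def)
  then have fst_v: "fst v = (1 - c) * fst u + c * fst w" by (simp add: algebra_simps)
  have "\<tau> * (fst w - fst u) =
      (snd v - snd u) * (fst w - fst v) - (snd w - snd v) * (fst v - fst u)"
    by (simp add: \<tau>_def fst_v algebra_simps)
  then have "\<tau> \<ge> 0" using neg lt by (smt (verit) mult_neg_pos)
  then have "u + (0, \<tau>) \<in> convex hull region" "w + (0, \<tau>) \<in> convex hull region"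
    using assms V_region by (auto intro: hull_region_upward)
  moreover have "v \<in> open_segment (u + (0, \<tau>)) (w + (0, \<tau>))"
    unfolding in_segment
  proof (intro conjI exI[of _ c])
    show "u + (0, \<tau>) \<noteq> w + (0, \<tau>)" using lt by auto
    show "v = (1 - c) *\<^sub>R (u + (0, \<tau>)) + c *\<^sub>R (w + (0, \<tau>))"
      using fst_v by (auto simp: prod_eq_iff \<tau>_def algebra_simps)
  qed (use c in auto)
  ultimately show False using assms(2) by (auto simp: vert_def extreme_point_of_def)
qed

section \<open>Vertices in boxes and dyadic strips\<close>

text \<open>The chain bound needs a finite set. Applied to all finite subsets of \<open>F\<close> it
  gives a uniform bound, and this forces \<open>F\<close> itself to be finite.\<close>

lemma card_V_in_box_le:
  assumes "F \<subseteq> V" and X: "X > 0" and Y: "Y > 0" and box: "F \<subseteq> {x0..x0 + X} \<times> {y0..y0 + Y}"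
  shows "finite F" "real (card F) \<le> 9 + 6 * (X * Y / \<delta>) powr (1 / 3)"
proof -
  have *: "real (card G) \<le> 9 + 6 * (X * Y / \<delta>) powr (1 / 3)" if "G \<subseteq> F" "finite G" for G
  proof (rule card_convex_chain_le[OF that(2) _ X Y])
    show "G \<subseteq> {x0..x0 + X} \<times> {y0..y0 + Y}" using that box by auto
    show "\<delta> > 0" using delta by simp
  next
    fix u v assume "u \<in> G" "v \<in> G" "u \<noteq> v" "fst u \<le> fst v"
    then show "fst u < fst v \<and> snd v < snd u" using V_antichain that assms(1) by blast
  next
    fix u v w assume "u \<in> G" "v \<in> G" "w \<in> G" "fst u < fst v" "fst v < fst w"
    then show "(snd v - snd u) * (fst w - fst v) < (snd w - snd v) * (fst v - fst u)"
      using V_strictly_convex that assms(1) by blast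
  next
    fix u v w z
    assume "u \<in> G" "v \<in> G" "w \<in> G" "z \<in> G"
    then have "u \<in> \<Gamma>" "v \<in> \<Gamma>" "w \<in> \<Gamma>" "z \<in> \<Gamma>"
      using that assms(1) V_region by (auto simp: region_def)
    then show "\<delta> \<le> \<bar>(fst v - fst u) * (snd z - snd w) - (fst z - fst w) * (snd v - snd u)\<bar>"
      if "(fst v - fst u) * (snd z - snd w) \<noteq> (fst z - fst w) * (snd v - snd u)"
      using that by (rule det)
  qed
  have "finite F \<and> card F \<le> nat \<lfloor>9 + 6 * (X * Y / \<delta>) powr (1 / 3)\<rfloor>"
    by (rule finite_if_finite_subsets_card_bdd) (use * le_nat_floor in blast)
  then show "finite F" ..
  then show "real (card F) \<le> 9 + 6 * (X * Y / \<delta>) powr (1 / 3)" using * by blast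
qed

text \<open>Otherwise the point one period \<open>\<delta>\<close> below \<open>v\<close> would
  still be in the region, as the point one period above is, and \<open>v\<close> would be their
  midpoint.\<close>

lemma V_near_hyperbola:
  assumes "v \<in> V"
  shows "fst v * (snd v - \<delta>) < \<nu>"
proof (rule ccontr)
  assume neg: "\<not> ?thesis"
  have v: "v \<in> region" using assms V_region by auto
  have "v - (0, \<delta>) \<in> \<Gamma>" using shift_snd[of v "-1"] v by (cases v) (simp add: region_def)
  then have "v - (0, \<delta>) \<in> region" using v neg by (auto simp: region_def)
  moreover have "v + (0, \<delta>) \<in> region"
    using v shift_snd[of v 1] delta by (intro region_add) (auto simp: region_def)
  ultimately have "(0, \<delta>) = (0 :: real \<times> real)"
    using assms extreme_point_symmetric_pair[of v "convex hull region" "(0, \<delta>)"]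
    by (simp add: vert_def hull_inc)
  then show False using delta by (simp add: prod_eq_iff)
qed

text \<open>Abscissas differ by integers, so only one column meets \<open>0 < s \<le> 1\<close>, and
  two points of one column are comparable. This leaves \<open>s > 1\<close> to the dyadic
  strips.\<close>

lemma card_first_column:
  "finite {v \<in> V. fst v \<le> 1}" "card {v \<in> V. fst v \<le> 1} \<le> 1"
proof -
  have "x = y" if x: "x \<in> {v \<in> V. fst v \<le> 1}" and y: "y \<in> {v \<in> V. fst v \<le> 1}" for x y
  proof -
    have *: "x \<in> region" "y \<in> region" using that V_region by auto
    obtain \<sigma> where \<sigma>: "fst ` \<Gamma> = {s. s - \<sigma> \<in> \<int>}" using columns by blast
    have "fst x - \<sigma> \<in> \<int>" "fst y - \<sigma> \<in> \<int>" using * \<sigma> by (auto simp: region_def)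
    then have "(fst x - \<sigma>) - (fst y - \<sigma>) \<in> \<int>" by (rule Ints_diff)
    then obtain i where i: "fst x - fst y = of_int i" by (auto elim: Ints_cases)
    have "\<bar>fst x - fst y\<bar> < 1" using x y region_pos[OF *(1)] region_pos[OF *(2)] by auto
    then have "i = 0" using i by linarith
    then have "fst x = fst y" using i by simp
    then show ?thesis using V_antichain[of x y] x y by force
  qed
  then obtain x where "{v \<in> V. fst v \<le> 1} \<subseteq> {x}" by blast
  then show "finite {v \<in> V. fst v \<le> 1}" "card {v \<in> V. fst v \<le> 1} \<le> 1"
    by (auto intro: finite_subset dest: card_mono[rotated])
qed

text \<open>A nonempty strip has \<open>\<delta> \<le> \<nu> / 2 ^ i\<close>, so the overshoot
  \<open>\<delta>\<close> above the hyperbola at most doubles the height bound. The vertices then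
  lie in a box of width \<open>2 ^ i\<close> and height \<open>2 * \<nu> / 2 ^ i\<close>, whose area
  does not depend on \<open>i\<close>.\<close>

lemma card_dyadic_strip:
  fixes i :: nat
  defines "F \<equiv> {v \<in> V. 2 ^ i \<le> fst v \<and> fst v \<le> 2 ^ Suc i \<and> fst v \<le> \<nu> / \<delta>}"
  shows "finite F" "real (card F) \<le> 9 + 12 * (\<nu> / \<delta>) powr (1 / 3)"
proof -
  have "finite F \<and> real (card F) \<le> 9 + 12 * (\<nu> / \<delta>) powr (1 / 3)"
  proof (cases "F = {}")
    case True
    then show ?thesis by simp
  next
    case False
    then have "2 ^ i \<le> \<nu> / \<delta>" by (auto simp: F_def)
    then have i: "\<delta> \<le> \<nu> / 2 ^ i" using delta by (simp add: field_simps)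
    have FV: "F \<subseteq> V" by (auto simp: F_def)
    have "snd v \<le> 2 * \<nu> / 2 ^ i" if "v \<in> F" for v
    proof -
      have v: "2 ^ i \<le> fst v" "v \<in> V" using that by (auto simp: F_def)
      have "fst v > 0" using v(1) by (smt (verit) zero_less_power)
      then have "snd v - \<delta> < \<nu> / fst v"
        using V_near_hyperbola[OF v(2)] by (simp add: pos_less_divide_eq mult.commute)
      also have "\<dots> \<le> \<nu> / 2 ^ i" using v(1) nu by (intro divide_left_mono) (auto intro: mult_pos_pos \<open>fst v > 0\<close>)
      finally show ?thesis using i by simp
    qed
    moreover have "0 \<le> snd v" if "v \<in> F" for v
      using that FV V_region region_pos by (meson less_imp_le subsetD)
    ultimately have box: "F \<subseteq> {2 ^ i..2 ^ i + 2 ^ i} \<times> {0..0 + 2 * \<nu> / 2 ^ i}"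
      by (auto simp: F_def)
    have "2 ^ i * (2 * \<nu> / 2 ^ i) / \<delta> = 2 * (\<nu> / \<delta>)" by simp
    then have *: "finite F" "real (card F) \<le> 9 + 6 * (2 * (\<nu> / \<delta>)) powr (1 / 3)"
      using card_V_in_box_le[OF FV _ _ box] nu by simp_all
    have "(2 * (\<nu> / \<delta>)) powr (1 / 3) = 2 powr (1 / 3) * (\<nu> / \<delta>) powr (1 / 3)" by (rule powr_mult)
    also have "\<dots> \<le> 2 powr 1 * (\<nu> / \<delta>) powr (1 / 3)"
      by (intro mult_right_mono powr_mono) auto
    finally show ?thesis using * by simp
  qed
  then show "finite F" "real (card F) \<le> 9 + 12 * (\<nu> / \<delta>) powr (1 / 3)" by auto
qed

text \<open>The first column contributes the summand 1; at most \<open>log 2 m + 1\<close> dyadic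
  strips cover the rest.\<close>

lemma card_left_part:
  assumes m: "m \<ge> 2" "\<nu> / \<delta> \<le> m"
  shows "finite {v \<in> V. fst v \<le> \<nu> / \<delta>}"
    "real (card {v \<in> V. fst v \<le> \<nu> / \<delta>}) \<le> 1 + (log 2 m + 1) * (21 * m powr (1 / 3))"
proof -
  \<comment> \<open>The exponents run from 0 to \<open>\<lfloor>log 2 m\<rfloor>\<close> inclusive,
    hence the \<open>+ 1\<close>.\<close>
  define L where "L = nat (\<lfloor>log 2 m\<rfloor> + 1)"
  define S where "S i = {v \<in> V. 2 ^ i \<le> fst v \<and> fst v \<le> 2 ^ Suc i \<and> fst v \<le> \<nu> / \<delta>}" for i :: nat
  have logm: "log 2 m \<ge> 1" using m by (simp add: le_log_iff)
  then have L: "real L \<le> log 2 m + 1" by (simp add: L_def)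
  have cover: "{v \<in> V. fst v \<le> \<nu> / \<delta>} \<subseteq> {v \<in> V. fst v \<le> 1} \<union> (\<Union>i<L. S i)"
  proof
    fix v assume v: "v \<in> {v \<in> V. fst v \<le> \<nu> / \<delta>}"
    show "v \<in> {v \<in> V. fst v \<le> 1} \<union> (\<Union>i<L. S i)"
    proof (cases "fst v \<le> 1")
      case True
      then show ?thesis using v by auto
    next
      case False
      define i where "i = nat \<lfloor>log 2 (fst v)\<rfloor>"
      have log0: "0 \<le> log 2 (fst v)" using False by simp
      have "real i \<le> log 2 (fst v)" "log 2 (fst v) \<le> real (Suc i)"
        using log0 unfolding i_def by linarith+
      then have "2 powr real i \<le> fst v" "fst v \<le> 2 powr real (Suc i)"
        using False by (simp_all add: le_log_iff log_le_iff)
      then have 2: "2 ^ i \<le> fst v" "fst v \<le> 2 ^ Suc i" by (simp_all only: powr_realpow zero_less_numeral)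
      have "log 2 (fst v) \<le> log 2 m" using v m False by simp
      then have "\<lfloor>log 2 (fst v)\<rfloor> \<le> \<lfloor>log 2 m\<rfloor>" by (rule floor_mono)
      then have "i < L" using log0 logm by (simp add: i_def L_def nat_less_iff)
      then show ?thesis using 2 v by (auto simp: S_def)
    qed
  qed
  have S: "finite (S i)" "real (card (S i)) \<le> 21 * m powr (1 / 3)" for i
  proof -
    show "finite (S i)" unfolding S_def by (rule card_dyadic_strip)
    have "real (card (S i)) \<le> 9 + 12 * (\<nu> / \<delta>) powr (1 / 3)"
      unfolding S_def by (rule card_dyadic_strip)
    moreover have "(\<nu> / \<delta>) powr (1 / 3) \<le> m powr (1 / 3)"
      using m nu delta by (intro powr_mono2) auto
    \<comment> \<open>This turns \<open>9 + 12 * m powr (1 / 3)\<close> into a multiple of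
      \<open>m powr (1 / 3)\<close> with factor 21.\<close>
    moreover have "1 \<le> m powr (1 / 3)" using m by (intro ge_one_powr_ge_zero) auto
    ultimately show "real (card (S i)) \<le> 21 * m powr (1 / 3)" by linarith
  qed
  have fin: "finite ({v \<in> V. fst v \<le> 1} \<union> (\<Union>i<L. S i))"
    using card_first_column S by auto
  then show "finite {v \<in> V. fst v \<le> \<nu> / \<delta>}" using cover finite_subset by blast
  have "card {v \<in> V. fst v \<le> \<nu> / \<delta>} \<le> card ({v \<in> V. fst v \<le> 1} \<union> (\<Union>i<L. S i))"
    using cover fin by (rule card_mono[rotated])
  also have "\<dots> \<le> card {v \<in> V. fst v \<le> 1} + card (\<Union>i<L. S i)" by (rule card_Un_le)
  also have "\<dots> \<le> 1 + (\<Sum>i<L. card (S i))"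
    using card_first_column(2) card_UN_le[of "{..<L}" S] by simp
  finally have "real (card {v \<in> V. fst v \<le> \<nu> / \<delta>}) \<le> real (1 + (\<Sum>i<L. card (S i)))"
    by (rule of_nat_mono)
  also have "\<dots> = 1 + (\<Sum>i<L. real (card (S i)))" by simp
  also have "(\<Sum>i<L. real (card (S i))) \<le> real L * (21 * m powr (1 / 3))"
    using sum_bounded_above[of "{..<L}" "\<lambda>i. real (card (S i))"] S(2) by simp
  also have "\<dots> \<le> (log 2 m + 1) * (21 * m powr (1 / 3))"
    using L by (intro mult_right_mono) auto
  finally show "real (card {v \<in> V. fst v \<le> \<nu> / \<delta>}) \<le> 1 + (log 2 m + 1) * (21 * m powr (1 / 3))"
    by simp
qed


text \<open>For \<open>s > 1\<close> and \<open>g s = \<nu> / s\<close>, the lowest point \<open>(s, t)\<close> of its column has \<open>t < g s + \<delta>\<close>, while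
  \<open>(g (s - 1) + g (s + 1)) / 2 - g s = \<nu> / (s\<^sup>3 - s) \<ge> \<delta>\<close>: so the line through \<open>(s, t)\<close> with the
  slope of the chord of \<open>g\<close> over \<open>[s - 1, s + 1]\<close> passes below \<open>g\<close> on all other columns.\<close>

lemma column_contains_vertex:
  assumes s: "s \<in> fst ` \<Gamma>" "0 < s" and R: "s \<le> R" "R ^ 3 \<le> \<nu> / \<delta>"
  shows "\<exists>t. (s, t) \<in> V"
proof -
  obtain t0 where t0: "(s, t0) \<in> \<Gamma>" using s by auto
  \<comment> \<open>The least number of periods that lifts \<open>t0\<close> to height at least
    \<open>\<nu> / s\<close>.\<close>
  define i where "i = \<lceil>(\<nu> / s - t0) / \<delta>\<rceil>"
  define t where "t = t0 + of_int i * \<delta>"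
  have "(\<nu> / s - t0) / \<delta> \<le> i" "i < (\<nu> / s - t0) / \<delta> + 1" unfolding i_def by linarith+
  then have t: "\<nu> / s \<le> t" "t < \<nu> / s + \<delta>" using delta by (simp_all add: t_def field_simps)
  have st: "(s, t) \<in> \<Gamma>" using shift_snd[OF t0, of i] by (simp add: t_def)
  have nu_st: "\<nu> \<le> s * t" using t(1) s(2) by (simp add: field_simps)
  then have in_region: "(s, t) \<in> region" using st s(2) by (simp add: region_def)
  have tpos: "t > 0" using region_pos[OF in_region] by simp
  obtain \<sigma> where \<sigma>: "fst ` \<Gamma> = {s. s - \<sigma> \<in> \<int>}" using columns by blast
  have step: "\<exists>j::int. fst z = s + j" if "z \<in> \<Gamma>" for z
  proof -
    have "fst z - \<sigma> \<in> \<int>" "s - \<sigma> \<in> \<int>" using that s(1) \<sigma> by auto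
    then have "(fst z - \<sigma>) - (s - \<sigma>) \<in> \<int>" by (rule Ints_diff)
    then show ?thesis by (auto elim!: Ints_cases simp: algebra_simps)
  qed
  have same_column: "t < snd z" if z: "z \<in> region" "fst z = s" "z \<noteq> (s, t)" for z
  proof -
    have zG: "z \<in> \<Gamma>" and zs: "\<nu> \<le> s * snd z" using z by (auto simp: region_def)
    \<comment> \<open>A point in the neighbouring column supplies a lattice vector of horizontal
      length 1, so \<open>det\<close> bounds vertical gaps within the column below by
      \<open>\<delta>\<close>.\<close>
    have "s + 1 \<in> fst ` \<Gamma>"
      using s(1) \<sigma> Ints_add[of "s - \<sigma>" 1] by (simp add: algebra_simps)
    then obtain w where w: "w \<in> \<Gamma>" "fst w = s + 1" by auto
    have ne: "snd z \<noteq> t" using z by (metis prod.collapse)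
    then have "\<delta> \<le> \<bar>snd z - t\<bar>"
      using det[OF st zG st w(1)] z(2) w(2) by simp
    moreover have "\<nu> / s \<le> snd z" using zs s(2) by (simp add: field_simps)
    ultimately show ?thesis using t by linarith
  qed
  have "\<exists>k<0. \<forall>x>0. \<bar>x - s\<bar> \<ge> 1 \<longrightarrow> x * (t + k * (x - s)) < \<nu>"
  \<comment> \<open>For \<open>s \<le> 1\<close> every other column has
    \<open>x \<ge> s + 1\<close>, where a line of slope \<open>- t\<close> has already come down to
    0 or below.\<close>
  proof (cases "s \<le> 1")
    case True
    show ?thesis
    proof (intro exI[of _ "- t"] conjI allI impI)
      fix x :: real assume x: "0 < x" "1 \<le> \<bar>x - s\<bar>"
      then have "x - s \<ge> 1" using True s(2) by linarith
      then have "t * 1 \<le> t * (x - s)" using tpos by (intro mult_left_mono) auto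
      then have "x * (t + - t * (x - s)) \<le> 0" using x by (intro mult_nonneg_nonpos) auto
      then show "x * (t + - t * (x - s)) < \<nu>" using nu by linarith
    qed (use tpos in auto)
  next
    case False
    then have s1: "s > 1" by simp
    define k where "k = (\<nu> / (s + 1) - \<nu> / (s - 1)) / 2"
    have s2: "s\<^sup>2 - 1 > 0" using s1 by (simp add: one_less_power)
    have "s ^ 3 - s \<le> R ^ 3" using R s(2) power_mono[of s R 3] by linarith
    then have "s ^ 3 - s \<le> \<nu> / \<delta>" using R(2) by linarith
    moreover have "s ^ 3 - s = s * (s\<^sup>2 - 1)" by (simp add: power2_eq_square power3_eq_cube algebra_simps)
    ultimately have "\<delta> \<le> \<nu> / (s * (s\<^sup>2 - 1))" using s2 s1 delta by (simp add: field_simps)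
    also have "\<dots> = (\<nu> / (s + 1) + \<nu> / (s - 1)) / 2 - \<nu> / s"
    proof -
      have ne: "s + 1 \<noteq> 0" "s - 1 \<noteq> 0" "s \<noteq> 0" using s1 by auto
      have e: "s\<^sup>2 - 1 = (s + 1) * (s - 1)" by (simp add: power2_eq_square algebra_simps)
      show ?thesis unfolding e using ne by (simp add: divide_simps) (simp add: algebra_simps)
    qed
    finally have "t < (\<nu> / (s + 1) + \<nu> / (s - 1)) / 2" using t(2) by linarith
    then have 1: "t + k < \<nu> / (s + 1)" and 3: "t - k < \<nu> / (s - 1)"
      unfolding k_def by argo+
    have 2: "(s + 1) * (t + k) < \<nu>" "(s - 1) * (t - k) < \<nu>"
      using 1 3 s1 by (simp_all add: pos_less_divide_eq mult.commute)
    have k: "k < 0" unfolding k_def using s1 nu by (simp add: frac_less2)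
    show ?thesis
    proof (intro exI[of _ k] conjI allI impI k)
      fix x :: real assume x: "0 < x" "1 \<le> \<bar>x - s\<bar>"
      define y where "y = x - s"
      \<comment> \<open>In \<open>y = x - s\<close> the excess over \<open>\<nu>\<close> is a
        quadratic with leading coefficient \<open>k < 0\<close>. Its negativity at
        \<open>y = 1\<close> and \<open>y = -1\<close> amounts to
        \<open>k + \<bar>\<beta>\<bar> + \<gamma> < 0\<close>, and this propagates to all
        \<open>\<bar>y\<bar> \<ge> 1\<close>.\<close>
      define \<beta> \<gamma> where "\<beta> = t + k * s" and "\<gamma> = s * t - \<nu>"
      have eq: "x * (t + k * (x - s)) - \<nu> = k * y\<^sup>2 + \<beta> * y + \<gamma>"
        by (simp add: y_def \<beta>_def \<gamma>_def power2_eq_square algebra_simps)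
      have g: "\<gamma> \<ge> 0" using nu_st by (simp add: \<gamma>_def)
      have b: "k + \<bar>\<beta>\<bar> + \<gamma> < 0" using 2 by (auto simp: \<beta>_def \<gamma>_def algebra_simps abs_if)
      have y1: "1 \<le> \<bar>y\<bar>" using x by (simp add: y_def)
      have "k * y\<^sup>2 + \<beta> * y + \<gamma> \<le> \<bar>y\<bar> * (k * \<bar>y\<bar> + \<bar>\<beta>\<bar> + \<gamma>)"
      proof -
        have "\<beta> * y \<le> \<bar>\<beta>\<bar> * \<bar>y\<bar>" by (metis abs_ge_self abs_mult)
        moreover have "1 * \<gamma> \<le> \<bar>y\<bar> * \<gamma>" using y1 g by (intro mult_right_mono) auto
        moreover have "k * y\<^sup>2 = \<bar>y\<bar> * (k * \<bar>y\<bar>)" by (simp add: power2_eq_square)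
        ultimately show ?thesis by (simp add: power2_eq_square algebra_simps)
      qed
      also have "\<dots> < 0"
      proof -
        have "k * \<bar>y\<bar> \<le> k * 1" using y1 k by (intro mult_left_mono_neg) auto
        then show ?thesis using b y1 by (intro mult_pos_neg) auto
      qed
      finally show "x * (t + k * (x - s)) < \<nu>" using eq by linarith
    qed
  qed
  then obtain k where below: "\<And>x. x > 0 \<Longrightarrow> \<bar>x - s\<bar> \<ge> 1 \<Longrightarrow> x * (t + k * (x - s)) < \<nu>" by blast
  define f :: "real \<times> real \<Rightarrow> real" where "f z = snd z - k * fst z" for z
  have "(s, t) extreme_point_of (convex hull region)"
  proof (rule extreme_point_of_convex_hull_strict_minimum[of f])
    show "linear f" unfolding f_def by (rule linearI) (auto simp: algebra_simps)
    show "(s, t) \<in> region" by (rule in_region)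
    fix w assume w: "w \<in> region" "w \<noteq> (s, t)"
    show "f (s, t) < f w"
    proof (cases "fst w = s")
      case True
      then show ?thesis using same_column[OF w(1) True w(2)] by (simp add: f_def)
    next
      case False
      obtain j :: int where j: "fst w = s + j" using step[of w] w by (auto simp: region_def)
      then have "\<bar>fst w - s\<bar> \<ge> 1" using False by simp
      then have "fst w * (t + k * (fst w - s)) < \<nu>" using below region_pos[OF w(1)] by blast
      also have "\<dots> \<le> fst w * snd w" using w(1) by (simp add: region_def)
      finally have "t + k * (fst w - s) < snd w" using region_pos[OF w(1)] by simp
      then show ?thesis by (simp add: f_def algebra_simps)
    qed
  qed
  then show ?thesis by (auto simp: vert_def)
qed

text \<open>At least \<open>\<lfloor>R\<rfloor>\<close> columns have \<open>0 < s \<le> R\<close>,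
  and each of them holds a vertex.\<close>

lemma card_V_small_fst_ge:
  assumes R: "R \<ge> 0" "R ^ 3 \<le> \<nu> / \<delta>" and fin: "finite V"
  shows "R - 1 \<le> real (card {v \<in> V. fst v \<le> R})"
proof -
  obtain \<sigma> where \<sigma>: "fst ` \<Gamma> = {s. s - \<sigma> \<in> \<int>}" using columns by blast
  \<comment> \<open>The first abscissa \<open>\<sigma> - \<lceil>\<sigma>\<rceil> + 1\<close> lies
    in the interval from 0 (excluded) to 1 (included), so \<open>s i \<le> i + 1\<close>.\<close>
  define s where "s i = \<sigma> - \<lceil>\<sigma>\<rceil> + 1 + real i" for i :: nat
  have "s i \<in> fst ` {v \<in> V. fst v \<le> R}" if "i < nat \<lfloor>R\<rfloor>" for i
  proof -
    have "s i - \<sigma> \<in> \<int>" by (simp add: s_def)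
    then have "s i \<in> fst ` \<Gamma>" using \<sigma> by blast
    moreover have "0 < s i" unfolding s_def by linarith
    moreover have "s i \<le> R" using that unfolding s_def by linarith
    ultimately show ?thesis using column_contains_vertex[of "s i" R] R by force
  qed
  then have sub: "s ` {..<nat \<lfloor>R\<rfloor>} \<subseteq> fst ` {v \<in> V. fst v \<le> R}" by blast
  have "inj_on s {..<nat \<lfloor>R\<rfloor>}" by (auto simp: inj_on_def s_def)
  then have "nat \<lfloor>R\<rfloor> = card (s ` {..<nat \<lfloor>R\<rfloor>})" by (simp add: card_image)
  also have "\<dots> \<le> card (fst ` {v \<in> V. fst v \<le> R})" using sub fin by (intro card_mono) auto
  also have "\<dots> \<le> card {v \<in> V. fst v \<le> R}" using fin by (intro card_image_le) auto
  finally show ?thesis using R by linarith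
qed

section \<open>Exchanging the two coordinates\<close>

text \<open>The locale assumptions are symmetric in the coordinates; every result on columns thereby
  yields one on rows.\<close>

lemma hyperbolic_coset_swap: "hyperbolic_coset (prod.swap ` \<Gamma>) \<delta> \<nu>"
proof
  show "\<delta> \<ge> 1" "\<nu> > 0" by (rule delta, rule nu)
  have eq: "z \<in> prod.swap ` \<Gamma> \<longleftrightarrow> prod.swap z \<in> \<Gamma>" for z by force
  show "u + v - w \<in> prod.swap ` \<Gamma>" if "u \<in> prod.swap ` \<Gamma>" "v \<in> prod.swap ` \<Gamma>" "w \<in> prod.swap ` \<Gamma>" for u v w
    using that parallelogram[of "prod.swap u" "prod.swap v" "prod.swap w"]
    unfolding eq by (simp add: prod.swap_def)
  show "\<delta> \<le> \<bar>(fst v - fst u) * (snd z - snd w) - (fst z - fst w) * (snd v - snd u)\<bar>"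
    if "u \<in> prod.swap ` \<Gamma>" "v \<in> prod.swap ` \<Gamma>" "w \<in> prod.swap ` \<Gamma>" "z \<in> prod.swap ` \<Gamma>"
      "(fst v - fst u) * (snd z - snd w) \<noteq> (fst z - fst w) * (snd v - snd u)" for u v w z
    using that det[of "prod.swap w" "prod.swap z" "prod.swap u" "prod.swap v"]
    unfolding eq by (simp add: mult.commute)
  show "z + (of_int i * \<delta>, 0) \<in> prod.swap ` \<Gamma>" if "z \<in> prod.swap ` \<Gamma>" for z i
    using that shift_snd[of "prod.swap z" i] unfolding eq by (simp add: prod.swap_def)
  show "z + (0, of_int i * \<delta>) \<in> prod.swap ` \<Gamma>" if "z \<in> prod.swap ` \<Gamma>" for z i
    using that shift_fst[of "prod.swap z" i] unfolding eq by (simp add: prod.swap_def)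
  show "\<exists>\<sigma>. fst ` prod.swap ` \<Gamma> = {s. s - \<sigma> \<in> \<int>}" using rows by (simp add: image_image)
  show "\<exists>\<sigma>. snd ` prod.swap ` \<Gamma> = {s. s - \<sigma> \<in> \<int>}" using columns by (simp add: image_image)
qed

interpretation swapped: hyperbolic_coset "prod.swap ` \<Gamma>" \<delta> \<nu>
  by (rule hyperbolic_coset_swap)

lemma swapped_region: "swapped.region = prod.swap ` region"
proof -
  have "z \<in> swapped.region \<longleftrightarrow> prod.swap z \<in> region" for z
  proof -
    have eq: "z \<in> prod.swap ` \<Gamma> \<longleftrightarrow> prod.swap z \<in> \<Gamma>" by force
    show ?thesis
      using swapped.region_pos[of z] region_pos[of "prod.swap z"]
      by (auto simp: swapped.region_def region_def eq mult.commute)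
  qed
  then show ?thesis by (force simp: image_iff)
qed

lemma swapped_V: "swapped.V = prod.swap ` V"
proof -
  have lin: "linear (prod.swap :: real \<times> real \<Rightarrow> real \<times> real)"
    by (rule linearI) (auto simp: prod.swap_def)
  show ?thesis unfolding swapped_region
    by (simp add: convex_hull_linear_image[OF lin, symmetric] vert_injective_linear_image[OF lin])
qed

lemma swapped_part: "{v \<in> swapped.V. fst v \<le> r} = prod.swap ` {v \<in> V. snd v \<le> r}"
  unfolding swapped_V by force

lemma card_swapped_part: "card {v \<in> swapped.V. fst v \<le> r} = card {v \<in> V. snd v \<le> r}"
  unfolding swapped_part by (rule card_image) simp

section \<open>The two bounds in the diagonal model\<close>

lemma V_upper_bound:
  assumes m: "2 * \<delta> \<le> m" "\<nu> / \<delta> \<le> m"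
  shows "finite V" "real (card V) \<le> 42 * m powr (1 / 3) * (log 2 m + 2)"
proof -
  let ?M = "\<nu> / \<delta>"
  have m2: "m \<ge> 2" using m delta by linarith
  define A B W where "A = {v \<in> V. fst v \<le> ?M}" and "B = {v \<in> V. snd v \<le> ?M}"
    and "W = {v \<in> V. ?M < fst v \<and> ?M < snd v}"
  have A: "finite A" "real (card A) \<le> 1 + (log 2 m + 1) * (21 * m powr (1 / 3))"
    unfolding A_def by (rule card_left_part[OF m2 m(2)])+
  have B: "finite B" "real (card B) \<le> 1 + (log 2 m + 1) * (21 * m powr (1 / 3))"
    using swapped.card_left_part[OF m2 m(2)] unfolding card_swapped_part
    by (simp_all add: B_def swapped_part finite_image_iff)
  have WV: "W \<subseteq> V" by (auto simp: W_def)
  \<comment> \<open>Beyond \<open>\<nu> / \<delta>\<close> the hyperbola is lower than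
    \<open>\<delta>\<close>, and a vertex exceeds it by less than another
    \<open>\<delta>\<close>.\<close>
  have near: "y < 2 * \<delta>" if "?M < x" "x * (y - \<delta>) < \<nu>" "0 < x" for x y
  proof (rule ccontr)
    assume "\<not> ?thesis"
    then have "x * \<delta> \<le> x * (y - \<delta>)" using that by (intro mult_left_mono) auto
    moreover have "\<nu> < x * \<delta>" using that(1) delta by (simp add: pos_divide_less_eq)
    ultimately show False using that(2) by linarith
  qed
  have "W \<subseteq> {0..0 + 2 * \<delta>} \<times> {0..0 + 2 * \<delta>}"
  proof
    fix v assume v: "v \<in> W"
    then have vV: "v \<in> V" and M: "?M < fst v" "?M < snd v" by (auto simp: W_def)
    have pos: "0 < fst v" "0 < snd v" using vV V_region region_pos by blast+
    have "snd v < 2 * \<delta>" using near[OF M(1) V_near_hyperbola[OF vV] pos(1)] .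
    moreover have "fst v < 2 * \<delta>"
    proof -
      have "prod.swap v \<in> swapped.V" using vV by (simp add: swapped_V)
      from swapped.V_near_hyperbola[OF this] show ?thesis using near[OF M(2) _ pos(2)] by simp
    qed
    ultimately show "v \<in> {0..0 + 2 * \<delta>} \<times> {0..0 + 2 * \<delta>}" using pos by (simp add: mem_Times_iff)
  qed
  from card_V_in_box_le[OF WV _ _ this] have W: "finite W"
    "real (card W) \<le> 9 + 6 * (2 * \<delta> * (2 * \<delta>) / \<delta>) powr (1 / 3)" using delta by auto
  \<comment> \<open>The quotient is \<open>4 * \<delta> \<le> 2 * m\<close>; it is relaxed to
    \<open>8 * m\<close> because 8 has cube root 2.\<close>
  have "(2 * \<delta> * (2 * \<delta>) / \<delta>) powr (1 / 3) \<le> (8 * m) powr (1 / 3)"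
    using m delta by (intro powr_mono2) auto
  also have "\<dots> = 2 * m powr (1 / 3)"
  proof -
    have "(8::real) powr (1 / 3) = (2 powr 3) powr (1 / 3)" by simp
    also have "\<dots> = 2" unfolding powr_powr by simp
    finally show ?thesis by (simp add: powr_mult)
  qed
  finally have W': "real (card W) \<le> 9 + 12 * m powr (1 / 3)" using W(2) by linarith
  have V: "V = A \<union> (B \<union> W)" by (auto simp: A_def B_def W_def)
  then show "finite V" using A B W by simp
  have "card V \<le> card A + (card B + card W)"
    using card_Un_le[of A "B \<union> W"] card_Un_le[of B W] unfolding V[symmetric] by linarith
  then have "real (card V) \<le> real (card A) + (real (card B) + real (card W))" by linarith
  also have "\<dots> \<le> 11 + 12 * m powr (1 / 3) + 2 * ((log 2 m + 1) * (21 * m powr (1 / 3)))"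
    using A(2) B(2) W' by linarith
  \<comment> \<open>The two outer parts account for \<open>42 = 2 * 21\<close>; the remainder
    \<open>11 + 12 * m powr (1 / 3)\<close> fits into the step from \<open>log 2 m + 1\<close> to
    \<open>log 2 m + 2\<close>.\<close>
  also have "\<dots> \<le> 42 * m powr (1 / 3) * (log 2 m + 2)"
  proof -
    have "1 \<le> m powr (1 / 3)" using m2 by (intro ge_one_powr_ge_zero) auto
    then show ?thesis by (simp add: algebra_simps)
  qed
  finally show "real (card V) \<le> 42 * m powr (1 / 3) * (log 2 m + 2)" .
qed

text \<open>For \<open>R > 1\<close> no vertex is counted both by columns and by rows: it would give
  \<open>\<nu> \<le> R * R < R ^ 3 = \<nu> / \<delta> \<le> \<nu>\<close>. For
  \<open>R \<le> 1\<close> the bound is not positive.\<close>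

lemma V_lower_bound: "2 * (\<nu> / \<delta>) powr (1 / 3) - 2 \<le> real (card V)"
proof -
  define R where "R = (\<nu> / \<delta>) powr (1 / 3)"
  have M: "\<nu> / \<delta> > 0" using nu delta by simp
  have R3: "R ^ 3 = \<nu> / \<delta>" unfolding R_def using M by (rule powr_third_cube)
  have R0: "R \<ge> 0" by (simp add: R_def)
  have fin: "finite V" using V_upper_bound[of "max (2 * \<delta>) (\<nu> / \<delta>)"] by simp
  show ?thesis
  proof (cases "R \<le> 1")
    case True
    then show ?thesis by (simp add: R_def)
  next
    case False
    let ?A = "{v \<in> V. fst v \<le> R}" and ?B = "{v \<in> V. snd v \<le> R}"
    have A: "R - 1 \<le> real (card ?A)" using card_V_small_fst_ge R0 R3 fin by simp
    have "R - 1 \<le> real (card {v \<in> swapped.V. fst v \<le> R})"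
      using swapped.card_V_small_fst_ge R0 R3 fin by (simp add: swapped_V)
    then have B: "R - 1 \<le> real (card ?B)" by (simp only: card_swapped_part)
    have "?A \<inter> ?B = {}"
    proof (rule ccontr)
      assume "?A \<inter> ?B \<noteq> {}"
      then obtain v where v: "v \<in> V" "fst v \<le> R" "snd v \<le> R" by auto
      then have r: "v \<in> region" using V_region by auto
      have "\<nu> / \<delta> \<le> \<nu>" using nu delta by (simp add: field_simps)
      also have "\<nu> \<le> fst v * snd v" using r by (simp add: region_def)
      also have "\<dots> \<le> R * R" using v region_pos[OF r] R0 by (intro mult_mono) auto
      finally have "R * (R * R) \<le> 1 * (R * R)" using R3 by (simp add: power3_eq_cube mult.assoc)
      moreover have "1 * (R * R) < R * (R * R)" using False by (intro mult_strict_right_mono) auto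
      ultimately show False by linarith
    qed
    then have "card ?A + card ?B = card (?A \<union> ?B)" using fin by (simp add: card_Un_disjoint)
    also have "\<dots> \<le> card V" using fin by (intro card_mono) auto
    finally show ?thesis using A B by (simp add: R_def)
  qed
qed

end

section \<open>Reduction to the diagonal hyperbola\<close>

text \<open>For \<open>a \<noteq> 0\<close>, \<open>4 * a\<close> times the form is the product of
  \<open>2 * a * x + (b - d) * y\<close> and \<open>2 * a * x + (b + d) * y\<close>. Dividing out
  their contents \<open>g\<close> and \<open>h\<close> leaves primitive factors and the constant
  \<open>g * h / (4 * a)\<close>, up to sign the \<open>\<kappa>\<close> sought.\<close>

lemma binary_quadratic_form_factorization:
  fixes a b c d :: int
  assumes d: "d > 0" "d\<^sup>2 = b\<^sup>2 - 4 * a * c"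
  obtains \<kappa> p q r s :: int where "\<kappa> \<ge> 1" "coprime p q" "coprime r s"
    "a = \<kappa> * (p * r)" "b = \<kappa> * (p * s + q * r)" "c = \<kappa> * (q * s)" "d = \<kappa> * \<bar>p * s - q * r\<bar>"
proof (cases "a = 0")
  case True
  \<comment> \<open>The form is now \<open>y * (b * x + c * y)\<close>, so only the second factor
    has a content to remove.\<close>
  then have "\<bar>b\<bar> = d" using d by (simp add: power2_eq_iff) auto
  then have b: "b \<noteq> 0" using d by auto
  define g where "g = gcd b c"
  have g: "g > 0" using b by (simp add: g_def)
  have bg: "b = g * (b div g)" "c = g * (c div g)" by (simp_all add: g_def)
  have "coprime (b div g) (c div g)" unfolding g_def using b by (intro div_gcd_coprime) simp
  moreover have "d = g * \<bar>0 * (c div g) - 1 * (b div g)\<bar>"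
    using \<open>\<bar>b\<bar> = d\<close> bg(1) g by (metis abs_minus_cancel abs_mult abs_of_pos diff_0 mult_1 mult_zero_left)
  ultimately show ?thesis
    using g bg True by (intro that[of g 0 1 "b div g" "c div g"]) auto
next
  case False
  define g h where "g = gcd (2 * a) (b - d)" and "h = gcd (2 * a) (b + d)"
  have ev: "even (b + d)"
  proof -
    have "even (b\<^sup>2 - d\<^sup>2)" using d(2) by simp
    then show ?thesis by simp
  qed
  then have ev': "even (b - d)" by presburger
  \<comment> \<open>An instance of Gauss's lemma: after expanding Bezout representations of
    \<open>g\<close> and \<open>h\<close>, every term is divisible by \<open>4 * a\<close>.\<close>
  have "4 * a dvd g * h"
  proof -
    obtain u v where uv: "u * (2 * a) + v * (b - d) = g" using bezout_int unfolding g_def by blast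
    obtain u' v' where uv': "u' * (2 * a) + v' * (b + d) = h" using bezout_int unfolding h_def by blast
    obtain e f where e: "b + d = 2 * e" and f: "b - d = 2 * f" using ev ev' by (meson evenE)
    have "(b - d) * (b + d) = 4 * a * c" using d(2) by (simp add: power2_eq_square algebra_simps)
    then have ef: "f * e = a * c" using e f by simp
    have "g * h = 4 * (u * u' * a * a + u * v' * a * e + v * u' * f * a + v * v' * (f * e))"
      unfolding uv[symmetric] uv'[symmetric] e f by (simp add: algebra_simps)
    also have "\<dots> = 4 * a * (u * u' * a + u * v' * e + v * u' * f + v * v' * c)"
      unfolding ef by (simp add: algebra_simps)
    finally show ?thesis by simp
  qed
  then obtain e where e: "g * h = 4 * a * e" by (elim dvdE)
  define p q r s where "p = 2 * a div g" and "q = (b - d) div g" and "r = 2 * a div h" and "s = (b + d) div h"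
  have eqs: "2 * a = g * p" "b - d = g * q" "2 * a = h * r" "b + d = h * s"
    unfolding p_def q_def r_def s_def g_def h_def by simp_all
  have cop: "coprime p q" "coprime r s"
    unfolding p_def q_def r_def s_def g_def h_def using False by (intro div_gcd_coprime; simp)+
  have "4 * a * (e * (p * r)) = (g * h) * (p * r)" unfolding e by simp
  also have "\<dots> = (g * p) * (h * r)" by (simp add: algebra_simps)
  also have "\<dots> = 4 * a * a" by (simp flip: eqs(1,3))
  finally have A: "a = e * (p * r)" using False by simp
  have "4 * a * (e * (p * s + q * r)) = (g * h) * (p * s + q * r)" unfolding e by simp
  also have "\<dots> = (g * p) * (h * s) + (g * q) * (h * r)" by (simp add: algebra_simps)
  also have "\<dots> = 2 * a * (b + d) + (b - d) * (2 * a)" by (simp only: eqs[symmetric])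
  also have "\<dots> = 4 * a * b" by (simp add: algebra_simps)
  finally have B: "b = e * (p * s + q * r)" using False by simp
  have "4 * a * (e * (q * s)) = (g * h) * (q * s)" unfolding e by simp
  also have "\<dots> = (g * q) * (h * s)" by (simp add: algebra_simps)
  also have "\<dots> = (b - d) * (b + d)" by (simp only: eqs[symmetric])
  also have "\<dots> = 4 * a * c" using d(2) by (simp add: power2_eq_square algebra_simps)
  finally have C: "c = e * (q * s)" using False by simp
  have "4 * a * (e * (p * s - q * r)) = (g * h) * (p * s - q * r)" unfolding e by simp
  also have "\<dots> = (g * p) * (h * s) - (g * q) * (h * r)" by (simp add: algebra_simps)
  also have "\<dots> = 2 * a * (b + d) - (b - d) * (2 * a)" by (simp only: eqs[symmetric])
  also have "\<dots> = 4 * a * d" by (simp add: algebra_simps)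
  finally have "d = e * (p * s - q * r)" using False by simp
  then have D: "d = \<bar>e\<bar> * \<bar>p * s - q * r\<bar>" using d(1) by (simp flip: abs_mult)
  show ?thesis
  proof (cases "e > 0")
    case True
    then show ?thesis using cop A B C D by (intro that[of e p q r s]) auto
  next
    \<comment> \<open>A negative constant is made positive by negating it together with the first
      linear factor.\<close>
    case False
    moreover have "e \<noteq> 0" using D d(1) by auto
    ultimately have "e < 0" by simp
    moreover have "\<bar>(- p) * s - (- q) * r\<bar> = \<bar>p * s - q * r\<bar>"
    proof -
      have "(- p) * s - (- q) * r = - (p * s - q * r)" by simp
      then show ?thesis by (simp only: abs_minus_cancel)
    qed
    ultimately show ?thesis
      using cop A B C D by (intro that[of "- e" "- p" "- q" r s]) (auto simp: algebra_simps)
  qed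
qed

section \<open>The convex components of the complement\<close>

text \<open>The complement splits into two convex sets \<open>A 1\<close> and
  \<open>A (- 1)\<close>, inside the branches, and a set \<open>M\<close> between them, starlike
  about the centre \<open>z0\<close>. A convex component cannot meet \<open>M\<close>, nor both
  branches, so it equals one of the \<open>A \<epsilon>\<close>.\<close>

lemma convex_component_complement_hyperbola:
  fixes f :: "real \<times> real \<Rightarrow> real \<times> real" and z0 :: "real \<times> real"
  defines "s \<equiv> \<lambda>z. fst (f (z - z0))" and "t \<equiv> \<lambda>z. snd (f (z - z0))"
  assumes f: "linear f" "surj f" and nu: "\<nu> > 0"
    and K: "K \<in> components (- {z. s z * t z = \<nu>})" "convex K"
  shows "\<exists>\<epsilon>\<in>{1, - 1}. closure K = {z. \<epsilon> * s z > 0 \<and> \<nu> \<le> s z * t z}"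
proof -
  interpret linear f by (rule f)
  have affine: "s (\<alpha> *\<^sub>R x + \<beta> *\<^sub>R y) = \<alpha> * s x + \<beta> * s y"
    "t (\<alpha> *\<^sub>R x + \<beta> *\<^sub>R y) = \<alpha> * t x + \<beta> * t y" if "\<alpha> + \<beta> = 1" for \<alpha> \<beta> x y
  proof -
    have "\<alpha> *\<^sub>R z0 + \<beta> *\<^sub>R z0 = z0" using that by (metis scaleR_left_distrib scaleR_one)
    then have "\<alpha> *\<^sub>R x + \<beta> *\<^sub>R y - z0 = \<alpha> *\<^sub>R (x - z0) + \<beta> *\<^sub>R (y - z0)"
      by (simp add: scaleR_diff_right algebra_simps)
    then show "s (\<alpha> *\<^sub>R x + \<beta> *\<^sub>R y) = \<alpha> * s x + \<beta> * s y"
      "t (\<alpha> *\<^sub>R x + \<beta> *\<^sub>R y) = \<alpha> * t x + \<beta> * t y"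
      by (simp_all add: s_def t_def add scale)
  qed
  have z0: "s z0 = 0" "t z0 = 0" by (simp_all add: s_def t_def zero)
  have onto: "\<exists>z. s z = x \<and> t z = y" for x y
  proof -
    obtain w where "f w = (x, y)" using f(2) by (metis surjD)
    then show ?thesis by (intro exI[of _ "w + z0"]) (simp add: s_def t_def)
  qed
  have bl: "bounded_linear f" using f(1) linear_conv_bounded_linear by blast
  have cont: "continuous_on UNIV s" "continuous_on UNIV t"
    unfolding s_def t_def by (intro continuous_intros bounded_linear.continuous_on[OF bl])+
  define A where "A \<epsilon> = {z. \<epsilon> * s z > 0 \<and> \<nu> < s z * t z}" for \<epsilon> :: real
  define M where "M = {z. s z * t z < \<nu>}"
  have cover: "- {z. s z * t z = \<nu>} = A 1 \<union> A (- 1) \<union> M"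
    using nu by (auto simp: A_def M_def) (metis less_asym' linorder_neqE_linordered_idom mult_eq_0_iff)
  have convA: "convex (A \<epsilon>)" if \<epsilon>: "\<epsilon> \<in> {1, - 1}" for \<epsilon>
  proof (rule convexI)
    fix x y :: "real \<times> real" and \<alpha> \<beta> :: real
    assume x: "x \<in> A \<epsilon>" and y: "y \<in> A \<epsilon>" and ab: "0 \<le> \<alpha>" "0 \<le> \<beta>" "\<alpha> + \<beta> = 1"
    have sq: "\<epsilon> * \<epsilon> = 1" using \<epsilon> by auto
    define S1 T1 S2 T2 where "S1 = \<epsilon> * s x" and "T1 = \<epsilon> * t x" and "S2 = \<epsilon> * s y" and "T2 = \<epsilon> * t y"
    have st: "s x * t x = S1 * T1" "s y * t y = S2 * T2"
      using sq by (simp_all add: S1_def T1_def S2_def T2_def mult_ac)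
    have pos: "S1 > 0" "S2 > 0" "\<nu> < S1 * T1" "\<nu> < S2 * T2"
      using x y by (auto simp: A_def st S1_def S2_def)
    then have T: "T1 > 0" "T2 > 0" using nu by (meson less_trans zero_less_mult_pos)+
    \<comment> \<open>The inequality of arithmetic and geometric means bounds the mixed terms of the
      product from below.\<close>
    have "\<nu> * \<nu> < (S1 * T1) * (S2 * T2)" using pos nu by (intro mult_strict_mono) auto
    moreover have "4 * ((S1 * T2) * (S2 * T1)) \<le> (S1 * T2 + S2 * T1)\<^sup>2"
      using zero_le_power2[of "S1 * T2 - S2 * T1"] by (simp add: power2_eq_square algebra_simps)
    ultimately have "(2 * \<nu>)\<^sup>2 < (S1 * T2 + S2 * T1)\<^sup>2" by (simp add: power2_eq_square algebra_simps)
    then have cross: "2 * \<nu> < S1 * T2 + S2 * T1"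
      using pos T by (intro power2_less_imp_less[of "2 * \<nu>"]) (auto simp: less_imp_le)
    have S: "\<epsilon> * s (\<alpha> *\<^sub>R x + \<beta> *\<^sub>R y) = \<alpha> * S1 + \<beta> * S2"
      and T': "\<epsilon> * t (\<alpha> *\<^sub>R x + \<beta> *\<^sub>R y) = \<alpha> * T1 + \<beta> * T2"
      using affine[OF ab(3)] by (simp_all add: S1_def S2_def T1_def T2_def algebra_simps)
    have "\<alpha> > 0 \<or> \<beta> > 0" using ab by linarith
    then have 1: "\<alpha> * S1 + \<beta> * S2 > 0"
      using pos ab by (smt (verit) mult_nonneg_nonneg mult_pos_pos)
    have "\<nu> = (\<alpha> + \<beta>)\<^sup>2 * \<nu>" using ab by simp
    also have "\<dots> = \<alpha>\<^sup>2 * \<nu> + \<beta>\<^sup>2 * \<nu> + \<alpha> * \<beta> * (2 * \<nu>)" by (simp add: power2_eq_square algebra_simps)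
    also have "\<dots> < \<alpha>\<^sup>2 * (S1 * T1) + \<beta>\<^sup>2 * (S2 * T2) + \<alpha> * \<beta> * (S1 * T2 + S2 * T1)"
    proof -
      have "\<alpha>\<^sup>2 * \<nu> \<le> \<alpha>\<^sup>2 * (S1 * T1)" "\<beta>\<^sup>2 * \<nu> \<le> \<beta>\<^sup>2 * (S2 * T2)"
        "\<alpha> * \<beta> * (2 * \<nu>) \<le> \<alpha> * \<beta> * (S1 * T2 + S2 * T1)"
        using pos cross ab by (auto intro!: mult_left_mono simp: less_imp_le)
      moreover have "\<alpha>\<^sup>2 * \<nu> < \<alpha>\<^sup>2 * (S1 * T1) \<or> \<beta>\<^sup>2 * \<nu> < \<beta>\<^sup>2 * (S2 * T2)"
        using \<open>\<alpha> > 0 \<or> \<beta> > 0\<close> pos by auto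
      ultimately show ?thesis by linarith
    qed
    also have "\<dots> = (\<alpha> * S1 + \<beta> * S2) * (\<alpha> * T1 + \<beta> * T2)"
      by (simp add: power2_eq_square algebra_simps)
    also have "\<dots> = s (\<alpha> *\<^sub>R x + \<beta> *\<^sub>R y) * t (\<alpha> *\<^sub>R x + \<beta> *\<^sub>R y)"
      unfolding S[symmetric] T'[symmetric] using sq by (metis mult.assoc mult.commute mult_1)
    finally show "\<alpha> *\<^sub>R x + \<beta> *\<^sub>R y \<in> A \<epsilon>" using 1 S by (simp add: A_def)
  qed
  have "starlike M"
    unfolding starlike_def
  proof (intro bexI[of _ z0] ballI subsetI)
    show "z0 \<in> M" using z0 nu by (simp add: M_def)
    fix x y assume x: "x \<in> M" and "y \<in> closed_segment z0 x"
    then obtain u where u: "0 \<le> u" "u \<le> 1" "y = (1 - u) *\<^sub>R z0 + u *\<^sub>R x" by (auto simp: in_segment)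
    have "s y = u * s x" "t y = u * t x" using affine[of "1 - u" u z0 x] z0 by (simp_all add: u(3))
    then have "s y * t y = (u * u) * (s x * t x)" by simp
    moreover have "0 \<le> u * u" "u * u \<le> 1" using u by (auto simp: mult_le_one)
    ultimately have "s y * t y < \<nu>"
      using x nu unfolding M_def mem_Collect_eq by (smt (verit) mult_left_le_one_le mult_nonneg_nonpos)
    then show "y \<in> M" by (simp add: M_def)
  qed
  then have connM: "connected M" by (rule starlike_imp_connected)
  have Ksub: "K \<subseteq> A 1 \<union> A (- 1) \<union> M" and Kne: "K \<noteq> {}"
    using in_components_subset[OF K(1)] in_components_nonempty[OF K(1)] cover by auto
  have maximal: "C \<subseteq> K" if "connected C" "C \<subseteq> - {z. s z * t z = \<nu>}" "K \<inter> C \<noteq> {}" for C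
    using components_maximal[OF K(1)] that by blast
  have KM: "K \<inter> M = {}"
  proof (rule ccontr)
    assume "K \<inter> M \<noteq> {}"
    then have sub: "M \<subseteq> K" using maximal connM by (auto simp: M_def)
    \<comment> \<open>Two points on the asymptotes, inside \<open>M\<close>, whose midpoint has both
      coordinates \<open>sqrt \<nu>\<close> and so lies on the hyperbola.\<close>
    obtain x where x: "s x = 2 * sqrt \<nu>" "t x = 0" using onto by blast
    obtain y where y: "s y = 0" "t y = 2 * sqrt \<nu>" using onto by blast
    have "x \<in> K" "y \<in> K" using sub x y nu by (auto simp: M_def)
    then have m: "(1/2) *\<^sub>R x + (1/2) *\<^sub>R y \<in> K" using K(2) by (intro convexD) auto
    have "s ((1/2) *\<^sub>R x + (1/2) *\<^sub>R y) * t ((1/2) *\<^sub>R x + (1/2) *\<^sub>R y) = \<nu>"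
      using affine[of "1/2" "1/2" x y] x y nu by simp
    then show False using m in_components_subset[OF K(1)] by auto
  qed
  have "\<exists>\<epsilon>\<in>{1, - 1}. K \<subseteq> A \<epsilon>"
  proof (rule ccontr)
    assume "\<not> ?thesis"
    then obtain x y where x: "x \<in> K" "x \<in> A 1" and y: "y \<in> K" "y \<in> A (- 1)"
      using Ksub KM by blast
    have sx: "s x > 0" and sy: "s y < 0" using x y by (auto simp: A_def)
    \<comment> \<open>At parameter \<open>c\<close> the segment from \<open>x\<close> to
      \<open>y\<close> crosses the asymptote \<open>s = 0\<close>, which is contained in
      \<open>M\<close>.\<close>
    define c where "c = s x / (s x - s y)"
    have c: "0 \<le> c" "c \<le> 1" using sx sy by (auto simp: c_def)
    have "(1 - c) * s x + c * s y = s x - c * (s x - s y)" by (simp add: algebra_simps)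
    also have "\<dots> = 0" using sx sy by (simp add: c_def)
    finally have "s ((1 - c) *\<^sub>R x + c *\<^sub>R y) = 0" using affine(1)[of "1 - c" c x y] by simp
    then have "(1 - c) *\<^sub>R x + c *\<^sub>R y \<in> M" using nu by (simp add: M_def)
    moreover have "(1 - c) *\<^sub>R x + c *\<^sub>R y \<in> K" using K(2) x y c by (intro convexD) auto
    ultimately show False using KM by blast
  qed
  then obtain \<epsilon> where \<epsilon>: "\<epsilon> \<in> {1, - 1}" "K \<subseteq> A \<epsilon>" by blast
  have "A \<epsilon> \<subseteq> K" using maximal[OF convex_connected[OF convA[OF \<epsilon>(1)]]] \<epsilon>(2) Kne by (auto simp: A_def)
  then have KA: "K = A \<epsilon>" using \<epsilon>(2) by blast
  have "closure (A \<epsilon>) = {z. \<epsilon> * s z > 0 \<and> \<nu> \<le> s z * t z}"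
  proof
    have "closed {z. \<epsilon> * s z \<ge> 0 \<and> \<nu> \<le> s z * t z}"
      by (intro closed_Collect_conj closed_Collect_le continuous_intros cont)
    then have "closure (A \<epsilon>) \<subseteq> {z. \<epsilon> * s z \<ge> 0 \<and> \<nu> \<le> s z * t z}"
      by (intro closure_minimal) (auto simp: A_def)
    moreover have "s z \<noteq> 0" if "\<nu> \<le> s z * t z" for z using that nu by auto
    ultimately show "closure (A \<epsilon>) \<subseteq> {z. \<epsilon> * s z > 0 \<and> \<nu> \<le> s z * t z}"
      using \<epsilon>(1) by (force simp: less_le)
  next
    show "{z. \<epsilon> * s z > 0 \<and> \<nu> \<le> s z * t z} \<subseteq> closure (A \<epsilon>)"
    proof
      fix z assume z: "z \<in> {z. \<epsilon> * s z > 0 \<and> \<nu> \<le> s z * t z}"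
      \<comment> \<open>Dilating from \<open>z0\<close> by a factor slightly above 1 pushes
        \<open>z\<close> strictly inside the branch.\<close>
      define y where "y n = (- inverse (real (Suc n))) *\<^sub>R z0 + (1 + inverse (real (Suc n))) *\<^sub>R z" for n
      have "y \<longlonglongrightarrow> (- 0) *\<^sub>R z0 + (1 + 0) *\<^sub>R z"
        unfolding y_def by (intro tendsto_intros LIMSEQ_inverse_real_of_nat)
      moreover have "y n \<in> A \<epsilon>" for n
      proof -
        define c where "c = 1 + inverse (real (Suc n))"
        have c: "c > 1" by (simp add: c_def)
        have eq: "s (y n) = c * s z" "t (y n) = c * t z"
          using affine[of "- inverse (real (Suc n))" "1 + inverse (real (Suc n))" z0 z] z0
          by (simp_all add: y_def c_def)
        have "s z * t z > 0" using z nu by auto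
        then have "1 * (s z * t z) < (c * c) * (s z * t z)"
          using c by (intro mult_strict_right_mono) (auto simp: less_1_mult)
        then have "\<nu> < s (y n) * t (y n)" using z by (simp add: eq mult_ac)
        moreover have "\<epsilon> * s (y n) = c * (\<epsilon> * s z)" by (simp add: eq)
        moreover have "c * (\<epsilon> * s z) > 0" using z c by (intro mult_pos_pos[of c]) auto
        ultimately show ?thesis by (simp only: A_def mem_Collect_eq)
      qed
      ultimately show "z \<in> closure (A \<epsilon>)" unfolding closure_sequential by auto
    qed
  qed
  then show ?thesis using \<epsilon>(1) KA by blast
qed

section \<open>Transporting the integer lattice by the linear factors\<close>

definition forms :: "int \<Rightarrow> int \<Rightarrow> int \<Rightarrow> int \<Rightarrow> real \<times> real \<Rightarrow> real \<times> real" where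
  "forms p q r s z = (p * fst z + q * snd z, r * fst z + s * snd z)"

lemma linear_forms: "linear (forms p q r s)"
  by (rule linearI) (auto simp: forms_def algebra_simps)

lemma inj_forms:
  assumes "p * s \<noteq> q * r"
  shows "inj (forms p q r s)"
  unfolding linear_injective_0[OF linear_forms]
proof (intro allI impI)
  fix z assume "forms p q r s z = 0"
  then have 1: "p * fst z + q * snd z = 0" and 2: "r * fst z + s * snd z = 0"
    by (auto simp: forms_def zero_prod_def)
  \<comment> \<open>Cramer's rule.\<close>
  have "(p * s - q * r) * fst z = s * (p * fst z + q * snd z) - q * (r * fst z + s * snd z)"
    "(p * s - q * r) * snd z = p * (r * fst z + s * snd z) - r * (p * fst z + q * snd z)"
    by (simp_all add: algebra_simps)
  moreover have "real_of_int (p * s - q * r) \<noteq> 0" using assms unfolding of_int_eq_0_iff by simp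
  ultimately show "z = 0" unfolding 1 2 by (simp add: prod_eq_iff)
qed

text \<open>By Bezout a primitive form takes every integer value; this provides the
  \<open>columns\<close> and \<open>rows\<close> assumptions.\<close>

lemma range_coprime_form:
  fixes p q :: int and \<sigma> :: real
  assumes "coprime p q"
  shows "(\<lambda>z :: real \<times> real. p * fst z + q * snd z + \<sigma>) ` (\<int> \<times> \<int>) = {x. x - \<sigma> \<in> \<int>}"
proof
  show "(\<lambda>z :: real \<times> real. p * fst z + q * snd z + \<sigma>) ` (\<int> \<times> \<int>) \<subseteq> {x. x - \<sigma> \<in> \<int>}" by auto
  show "{x. x - \<sigma> \<in> \<int>} \<subseteq> (\<lambda>z :: real \<times> real. p * fst z + q * snd z + \<sigma>) ` (\<int> \<times> \<int>)"
  proof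
    fix x assume "x \<in> {x. x - \<sigma> \<in> \<int>}"
    then obtain j :: int where j: "x = j + \<sigma>" by (auto elim!: Ints_cases simp: algebra_simps)
    obtain u v where "u * p + v * q = 1" using assms bezout_int[of p q] by auto
    then have "real_of_int (u * p + v * q) = 1" by simp
    then have "j * (u * p + v * q) = (j::real)" by simp
    then have "x = p * fst (real_of_int (j * u), real_of_int (j * v))
        + q * snd (real_of_int (j * u), real_of_int (j * v)) + \<sigma>"
      by (simp add: j algebra_simps)
    then show "x \<in> (\<lambda>z :: real \<times> real. p * fst z + q * snd z + \<sigma>) ` (\<int> \<times> \<int>)" by (rule image_eqI) auto
  qed
qed

text \<open>The linear map multiplies determinants by \<open>d = p * s - q * r\<close>, and a
  nonzero integer determinant has absolute value at least 1.\<close>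

lemma hyperbolic_coset_forms:
  assumes cop: "coprime p q" "coprime r s" and ne: "p * s \<noteq> q * r" and nu: "\<nu> > 0"
  shows "hyperbolic_coset ((\<lambda>z. forms p q r s (z - z0)) ` (\<int> \<times> \<int>)) \<bar>p * s - q * r\<bar> \<nu>"
proof -
  define \<phi> where "\<phi> z = forms p q r s (z - z0)" for z :: "real \<times> real"
  define d where "d = p * s - q * r"
  have \<phi>: "fst (\<phi> z) = p * fst z + q * snd z + - (p * fst z0 + q * snd z0)"
    "snd (\<phi> z) = r * fst z + s * snd z + - (r * fst z0 + s * snd z0)" for z :: "real \<times> real"
    by (simp_all add: \<phi>_def forms_def algebra_simps)
  have shift: "sgn d * d = \<bar>d\<bar>" by (simp add: mult.commute abs_sgn)
  have "hyperbolic_coset (\<phi> ` (\<int> \<times> \<int>)) \<bar>d\<bar> \<nu>"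
  proof
    have "1 \<le> \<bar>d\<bar>" using ne by (simp add: d_def)
    then show "real_of_int \<bar>d\<bar> \<ge> 1" by (simp only: of_int_1_le_iff)
    show "\<nu> > 0" by (rule nu)
    show "u + v - w \<in> \<phi> ` (\<int> \<times> \<int>)"
      if "u \<in> \<phi> ` (\<int> \<times> \<int>)" "v \<in> \<phi> ` (\<int> \<times> \<int>)" "w \<in> \<phi> ` (\<int> \<times> \<int>)" for u v w :: "real \<times> real"
    proof -
      obtain x y z where xyz: "x \<in> \<int> \<times> \<int>" "y \<in> \<int> \<times> \<int>" "z \<in> \<int> \<times> \<int>" "u = \<phi> x" "v = \<phi> y" "w = \<phi> z"
        using \<open>u \<in> _\<close> \<open>v \<in> _\<close> \<open>w \<in> _\<close> by auto
      then have "u + v - w = \<phi> (x + y - z)" by (simp add: prod_eq_iff \<phi> algebra_simps)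
      moreover have "x + y - z \<in> \<int> \<times> \<int>" using xyz by (auto simp: mem_Times_iff)
      ultimately show ?thesis by (rule image_eqI)
    qed
    show "\<bar>d\<bar> \<le> \<bar>(fst v - fst u) * (snd z - snd w) - (fst z - fst w) * (snd v - snd u)\<bar>"
      if mem: "u \<in> \<phi> ` (\<int> \<times> \<int>)" "v \<in> \<phi> ` (\<int> \<times> \<int>)" "w \<in> \<phi> ` (\<int> \<times> \<int>)" "z \<in> \<phi> ` (\<int> \<times> \<int>)"
        and "(fst v - fst u) * (snd z - snd w) \<noteq> (fst z - fst w) * (snd v - snd u)" for u v w z :: "real \<times> real"
    proof -
      from mem(1) obtain u' where u': "u = \<phi> u'" "u' \<in> \<int> \<times> \<int>" by (rule imageE)
      from mem(2) obtain v' where v': "v = \<phi> v'" "v' \<in> \<int> \<times> \<int>" by (rule imageE)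
      from mem(3) obtain w' where w': "w = \<phi> w'" "w' \<in> \<int> \<times> \<int>" by (rule imageE)
      from mem(4) obtain z' where z': "z = \<phi> z'" "z' \<in> \<int> \<times> \<int>" by (rule imageE)
      define D where "D = (fst v' - fst u') * (snd z' - snd w') - (fst z' - fst w') * (snd v' - snd u')"
      have eq: "(fst v - fst u) * (snd z - snd w) - (fst z - fst w) * (snd v - snd u) = d * D"
        unfolding u' v' w' z' \<phi> D_def d_def by (simp add: algebra_simps)
      have "D \<in> \<int>" using u'(2) v'(2) w'(2) z'(2) unfolding D_def by (simp add: mem_Times_iff)
      moreover have "D \<noteq> 0" using that(5) eq by (metis mult_zero_right right_minus_eq)
      ultimately have "1 \<le> \<bar>D\<bar>" by (rule Ints_nonzero_abs_ge1)
      then have "\<bar>real_of_int d\<bar> * 1 \<le> \<bar>real_of_int d\<bar> * \<bar>D\<bar>" by (intro mult_left_mono) auto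
      then show ?thesis unfolding eq abs_mult by simp
    qed
    show "z + (of_int i * real_of_int \<bar>d\<bar>, 0) \<in> \<phi> ` (\<int> \<times> \<int>)" if z: "z \<in> \<phi> ` (\<int> \<times> \<int>)" for z :: "real \<times> real" and i
    proof -
      obtain w where w: "w \<in> \<int> \<times> \<int>" "z = \<phi> w" using z by auto
      \<comment> \<open>A multiple of the first column of the adjugate matrix, mapped by the forms
        to a horizontal vector; the second column serves for vertical shifts.\<close>
      define e :: "real \<times> real" where "e = (of_int (i * sgn d * s), of_int (- i * sgn d * r))"
      have "z + (of_int i * real_of_int \<bar>d\<bar>, 0) = \<phi> (w + e)"
        unfolding shift[symmetric] w(2) prod_eq_iff
        by (simp add: \<phi> e_def) (simp add: d_def algebra_simps)
      moreover have "w + e \<in> \<int> \<times> \<int>" using w(1) by (auto simp: mem_Times_iff e_def)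
      ultimately show ?thesis by (rule image_eqI)
    qed
    show "z + (0, of_int i * real_of_int \<bar>d\<bar>) \<in> \<phi> ` (\<int> \<times> \<int>)" if z: "z \<in> \<phi> ` (\<int> \<times> \<int>)" for z :: "real \<times> real" and i
    proof -
      obtain w where w: "w \<in> \<int> \<times> \<int>" "z = \<phi> w" using z by auto
      define e :: "real \<times> real" where "e = (of_int (- i * sgn d * q), of_int (i * sgn d * p))"
      have "z + (0, of_int i * real_of_int \<bar>d\<bar>) = \<phi> (w + e)"
        unfolding shift[symmetric] w(2) prod_eq_iff
        by (simp add: \<phi> e_def) (simp add: d_def algebra_simps)
      moreover have "w + e \<in> \<int> \<times> \<int>" using w(1) by (auto simp: mem_Times_iff e_def)
      ultimately show ?thesis by (rule image_eqI)
    qed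
    show "\<exists>\<sigma>. fst ` \<phi> ` (\<int> \<times> \<int>) = {x. x - \<sigma> \<in> \<int>}"
      unfolding image_image \<phi> using range_coprime_form[OF cop(1)] by blast
    show "\<exists>\<sigma>. snd ` \<phi> ` (\<int> \<times> \<int>) = {x. x - \<sigma> \<in> \<int>}"
      unfolding image_image \<phi> using range_coprime_form[OF cop(2)] by blast
  qed
  then show ?thesis by (simp add: \<phi>_def d_def)
qed

lemma card_vert_affine_image:
  fixes f :: "real \<times> real \<Rightarrow> real \<times> real" and z0 :: "real \<times> real"
  assumes f: "linear f" "inj f"
  defines "\<phi> \<equiv> \<lambda>z. f (z - z0)"
  shows "finite (vert (convex hull (\<phi> ` S))) \<longleftrightarrow> finite (vert (convex hull S))"
    "card (vert (convex hull (\<phi> ` S))) = card (vert (convex hull S))"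
proof -
  define c where "c = - f z0"
  have "\<phi> ` S = (+) c ` f ` S"
    unfolding \<phi>_def c_def using linear_diff[OF f(1)] by (simp add: image_image)
  then have "convex hull (\<phi> ` S) = (+) c ` f ` (convex hull S)"
    by (simp only: convex_hull_translation convex_hull_linear_image[OF f(1)])
  then have eq: "vert (convex hull (\<phi> ` S)) = (+) c ` f ` vert (convex hull S)"
    using extreme_points_of_translation[of c "f ` (convex hull S)"]
      vert_injective_linear_image[OF f, of "convex hull S"]
    by (simp add: vert_def)
  have inj: "inj_on f A" for A using f(2) by (rule inj_on_subset) simp
  show "finite (vert (convex hull (\<phi> ` S))) \<longleftrightarrow> finite (vert (convex hull S))"
    "card (vert (convex hull (\<phi> ` S))) = card (vert (convex hull S))"
    unfolding eq by (simp_all add: finite_image_iff card_image inj)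
qed

section \<open>Assembly for the original hyperbola\<close>

text \<open>Finiteness is claimed explicitly because \<open>card\<close> is 0 on infinite sets,
  which would make the upper bound empty of content.\<close>

theorem theorem1p1:
  "\<exists>C::real. \<forall>(a::real) (b::real) (c::real) (n::real) (x0::real) (y0::real) (\<Delta>::real) (m::real)
      (H :: (real \<times> real) set).
     n \<noteq> 0 \<longrightarrow>
     \<Delta> = sqrt (b\<^sup>2 - 4 * a * c) \<longrightarrow> \<Delta> > 0 \<longrightarrow>
     a \<in> \<int> \<longrightarrow> b \<in> \<int> \<longrightarrow> c \<in> \<int> \<longrightarrow> \<Delta> \<in> \<int> \<longrightarrow>
     (\<exists>K \<in> components (- hyperbola a b c n x0 y0). convex K \<and> H = closure K) \<longrightarrow>
     m = max (2 * \<Delta>) (\<bar>n\<bar> / \<Delta>) \<longrightarrow>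
     finite (vert (convex hull (H \<inter> \<int> \<times> \<int>))) \<and>
     2 * (\<bar>n\<bar> / \<Delta>) powr (1 / 3) - 2 \<le> real (card (vert (convex hull (H \<inter> \<int> \<times> \<int>)))) \<and>
     real (card (vert (convex hull (H \<inter> \<int> \<times> \<int>)))) \<le> C * m powr (1 / 3) * (log 2 m + 2)"
proof (intro exI[of _ 42] allI impI)
  fix a b c n x0 y0 \<Delta> m :: real and H :: "(real \<times> real) set"
  assume n: "n \<noteq> 0" and \<Delta>: "\<Delta> = sqrt (b\<^sup>2 - 4 * a * c)" "\<Delta> > 0"
    and ints: "a \<in> \<int>" "b \<in> \<int>" "c \<in> \<int>" "\<Delta> \<in> \<int>"
    and "\<exists>K \<in> components (- hyperbola a b c n x0 y0). convex K \<and> H = closure K"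
    and m: "m = max (2 * \<Delta>) (\<bar>n\<bar> / \<Delta>)"
  then obtain K where K: "K \<in> components (- hyperbola a b c n x0 y0)" "convex K" "H = closure K" by blast
  obtain a' b' c' d :: int where ab: "a = a'" "b = b'" "c = c'" "\<Delta> = d"
    using ints by (auto elim!: Ints_cases)
  have "\<Delta>\<^sup>2 = b\<^sup>2 - 4 * a * c"
    using \<Delta> by (metis less_le real_sqrt_gt_0_iff real_sqrt_pow2)
  then have "real_of_int (d\<^sup>2) = real_of_int (b'\<^sup>2 - 4 * a' * c')" by (simp add: ab)
  then have d2: "d\<^sup>2 = b'\<^sup>2 - 4 * a' * c'" by (simp only: of_int_eq_iff)
  have d0: "d > 0" using \<Delta>(2) ab by simp
  obtain \<kappa> p q r s :: int where fac: "\<kappa> \<ge> 1" "coprime p q" "coprime r s"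
    "a' = \<kappa> * (p * r)" "b' = \<kappa> * (p * s + q * r)" "c' = \<kappa> * (q * s)" "d = \<kappa> * \<bar>p * s - q * r\<bar>"
    using binary_quadratic_form_factorization[OF d0 d2] by blast
  have \<kappa>: "real_of_int \<kappa> \<ge> 1" using fac(1) by simp
  define \<nu> where "\<nu> = \<bar>n\<bar> / \<kappa>"
  define \<delta> where "\<delta> = \<bar>p * s - q * r\<bar>"
  define z0 where "z0 = (x0, y0)"
  have nu: "\<nu> > 0" using n \<kappa> by (simp add: \<nu>_def)
  have ne: "p * s \<noteq> q * r" using fac(7) d0 by auto
  \<comment> \<open>The sign of \<open>n\<close> goes into the first form, so that the product of
    the forms equals the positive number \<open>\<nu>\<close>.\<close>
  define e :: int where "e = (if n > 0 then 1 else - 1)"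
  let ?f = "forms (e * p) (e * q) r s"
  have ne': "(e * p) * s \<noteq> (e * q) * r" using ne by (auto simp: e_def)
  have hyp: "hyperbola a b c n x0 y0 = {z. fst (?f (z - z0)) * snd (?f (z - z0)) = \<nu>}"
  proof -
    have "a * (x - x0)\<^sup>2 + b * (x - x0) * (y - y0) + c * (y - y0)\<^sup>2 = n \<longleftrightarrow>
        fst (?f ((x, y) - z0)) * snd (?f ((x, y) - z0)) = \<nu>" for x y
    proof -
      have "e * (fst (?f ((x, y) - z0)) * snd (?f ((x, y) - z0))) * \<kappa>
          = a * (x - x0)\<^sup>2 + b * (x - x0) * (y - y0) + c * (y - y0)\<^sup>2"
        unfolding ab fac(4-6) by (auto simp: e_def forms_def z0_def power2_eq_square algebra_simps)
      moreover have "n = e * \<nu> * \<kappa>" using \<kappa> by (simp add: e_def \<nu>_def)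
      moreover have "real_of_int e \<noteq> 0" by (simp add: e_def)
      ultimately show ?thesis using \<kappa> by (auto simp: mult_ac)
    qed
    then show ?thesis by (auto simp: hyperbola_def)
  qed
  have surj: "surj ?f"
    by (rule linear_injective_imp_surjective[OF linear_forms inj_forms[OF ne'] refl])
  obtain \<epsilon> :: real where \<epsilon>: "\<epsilon> \<in> {1, - 1}"
    "H = {z. \<epsilon> * fst (?f (z - z0)) > 0 \<and> \<nu> \<le> fst (?f (z - z0)) * snd (?f (z - z0))}"
    using convex_component_complement_hyperbola[OF linear_forms surj nu K(1)[unfolded hyp] K(2)] K(3)
    by blast
  \<comment> \<open>Changing the sign of both forms keeps their product and moves \<open>H\<close>
    to the side where the first form is positive.\<close>
  define i :: int where "i = (if \<epsilon> = 1 then 1 else - 1)"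
  let ?g = "forms (i * (e * p)) (i * (e * q)) (i * r) (i * s)"
  have neg: "(i * (e * p)) * (i * s) \<noteq> (i * (e * q)) * (i * r)" using ne' by (auto simp: i_def)
  have H: "H = {z. fst (?g (z - z0)) > 0 \<and> \<nu> \<le> fst (?g (z - z0)) * snd (?g (z - z0))}"
    using \<epsilon> by (auto simp: i_def forms_def algebra_simps)
  have \<delta>: "\<bar>(i * (e * p)) * (i * s) - (i * (e * q)) * (i * r)\<bar> = \<delta>"
    by (auto simp: \<delta>_def i_def e_def)
  have cop: "coprime (i * (e * p)) (i * (e * q))" "coprime (i * r) (i * s)"
    using fac by (auto simp: i_def e_def)
  interpret hyperbolic_coset "(\<lambda>z. ?g (z - z0)) ` (\<int> \<times> \<int>)" \<delta> \<nu>
    using hyperbolic_coset_forms[OF cop neg nu] unfolding \<delta> .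
  have region: "region = (\<lambda>z. ?g (z - z0)) ` (H \<inter> \<int> \<times> \<int>)"
    unfolding region_def H by auto
  note vert = card_vert_affine_image[OF linear_forms inj_forms[OF neg], of z0 "H \<inter> \<int> \<times> \<int>", folded region]
  have \<Delta>_eq: "\<Delta> = \<kappa> * \<delta>" using fac(7) by (simp add: ab \<delta>_def)
  have ratio: "\<nu> / \<delta> = \<bar>n\<bar> / \<Delta>" using \<kappa> by (simp add: \<nu>_def \<Delta>_eq)
  \<comment> \<open>The model only knows \<open>\<delta>\<close>; \<open>\<kappa> \<ge> 1\<close>
    gives \<open>2 * \<delta> \<le> 2 * \<Delta> \<le> m\<close>, while the ratio
    \<open>\<nu> / \<delta>\<close> agrees with \<open>\<bar>n\<bar> / \<Delta>\<close>
    exactly.\<close>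
  have "1 * real_of_int \<delta> \<le> real_of_int \<kappa> * real_of_int \<delta>" using \<kappa> delta by (intro mult_right_mono) auto
  then have "2 * real_of_int \<delta> \<le> m" "\<nu> / \<delta> \<le> m" unfolding m ratio \<Delta>_eq by auto
  then show "finite (vert (convex hull (H \<inter> \<int> \<times> \<int>))) \<and>
     2 * (\<bar>n\<bar> / \<Delta>) powr (1 / 3) - 2 \<le> real (card (vert (convex hull (H \<inter> \<int> \<times> \<int>)))) \<and>
     real (card (vert (convex hull (H \<inter> \<int> \<times> \<int>)))) \<le> 42 * m powr (1 / 3) * (log 2 m + 2)"
    using V_upper_bound[of m] V_lower_bound unfolding vert ratio by blast
qed

end
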